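(* Let $N\ge1$, $s\in(0,1)$, let $u_0\in C_0^\infty(\mathbb{R}^N)$ with $\operatorname{supp}(u_0)\subset B_L(0)$ for some $L>0$, and let $w=w(x,t)$ be the solution of the Cauchy problem for the fractional wave equation $$\partial_t^2w+(-\Delta)^sw=0\ \text{ in }\mathbb{R}^N\times(0,\infty),\qquad w(x,0)=0,\quad \partial_tw(x,0)=u_0(x)\ \text{ for }x\in\mathbb{R}^N.$$ Then the following conditions are equivalent: (1) $w(0,t)=0$ for any $t>0$; (2) $\displaystyle\int_{\mathbb{S}^{N-1}}u_0(r\omega)\,d\omega=0$ for any $r\ge0$.
   Context: $B_L(0)$ is the open ball of radius $L$ centered at the origin of $\mathbb{R}^N$; $\mathbb{S}^{N-1}$ is the unit sphere centered at the origin with surface measure $d\omega$ (counting measure on $\{\pm1\}$ if $N=1$). The fractional Laplacian is $(-\Delta)^s u(x)=c_{N,s}\lim_{\varepsilon\to0^+}\int_{|y-x|>\varepsilon}\frac{u(x)-u(y)}{|x-y|^{N+2s}}\,dy$ with $c_{N,s}=\frac{2^{2s}s\,\Gamma((N+2s)/2)}{\pi^{N/2}\Gamma(1-s)}$; equivalently, with the Fourier transform $\mathcal{F}f(\xi)=\int_{\mathbb{R}^N}f(x)e^{-2\pi i x\cdot\xi}dx$, it is the Fourier multiplier with symbol $(2\pi|\xi|)^{2s}$. The solution of the Cauchy problem is the smooth one obtained by Fourier transform in $x$: $w(\cdot,t)=\mathcal{F}^{-1}\Big(\frac{\sin(t(2\pi|\xi|)^s)}{(2\pi|\xi|)^s}\,\mathcal{F}u_0(\xi)\Big)$.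 *)

theory Defs
  imports "HOL-Analysis.Analysis"
begin

text \<open>The space \<open>\<real>\<^sup>N\<close> is a type of class \<open>euclidean_space\<close>, with \<open>N = DIM('a) \<ge> 1\<close>.\<close>

subsection \<open>Smooth functions with compact support\<close>

text \<open>For open \<open>S\<close>, \<open>Ck_on k S f\<close> says that \<open>f\<close> is of class \<open>C\<^sup>k\<close> on \<open>S\<close>:
  all iterated directional derivatives of order at most \<open>k\<close> exist and are continuous on \<open>S\<close>.\<close>

primrec Ck_on ::
  "nat \<Rightarrow> 'a::euclidean_space set \<Rightarrow> ('a \<Rightarrow> 'b::real_normed_vector) \<Rightarrow> bool" where
  "Ck_on 0 S f \<longleftrightarrow> continuous_on S f"
| "Ck_on (Suc k) S f \<longleftrightarrow>
     (\<forall>x\<in>S. f differentiable (at x)) \<and>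
     (\<forall>v. Ck_on k S (\<lambda>x. frechet_derivative f (at x) v))"

definition smooth_on :: "'a::euclidean_space set \<Rightarrow> ('a \<Rightarrow> 'b::real_normed_vector) \<Rightarrow> bool" where
  "smooth_on S f \<longleftrightarrow> (\<forall>k. Ck_on k S f)"

definition supp :: "('a::topological_space \<Rightarrow> 'b::zero) \<Rightarrow> 'a set" where
  "supp f = closure {x. f x \<noteq> 0}"

definition test_function :: "('a::euclidean_space \<Rightarrow> 'b::real_normed_vector) \<Rightarrow> bool" where
  "test_function f \<longleftrightarrow> smooth_on UNIV f \<and> compact (supp f)"

subsection \<open>Surface measure of the unit sphere\<close>

text \<open>The surface measure \<open>\<sigma>\<close> is given by \<open>\<sigma>(A) = N \<cdot> vol {r\<omega>. 0 < r < 1 \<and> \<omega> \<in> A}\<close>, i.e. it is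
  \<open>N\<close> times the image of Lebesgue measure on the punctured unit ball under \<open>x \<mapsto> x / |x|\<close>.\<close>

definition sphere_measure :: "'a::euclidean_space measure" where
  "sphere_measure =
     scale_measure (of_nat DIM('a))
       (distr (restrict_space lborel (ball 0 1 - {0})) (restrict_space borel (sphere 0 1)) sgn)"

lemma space_sphere_measure: "space (sphere_measure :: 'a::euclidean_space measure) = sphere 0 1"
  by (simp add: sphere_measure_def space_scale_measure space_restrict_space)

lemma sets_sphere_measure:
  "sets (sphere_measure :: 'a::euclidean_space measure) = sets (restrict_space borel (sphere 0 1))"
  by (simp add: sphere_measure_def)

lemma measurable_sgn_sphere:
  "(sgn :: 'a::euclidean_space \<Rightarrow> 'a) \<in>
     restrict_space lborel (ball 0 1 - {0}) \<rightarrow>\<^sub>M restrict_space borel (sphere 0 1)"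
proof (rule measurable_restrict_space2)
  show "sgn \<in> space (restrict_space lborel (ball 0 1 - {0::'a})) \<rightarrow> sphere 0 1"
    by (auto simp: space_restrict_space norm_sgn)
  have "(\<lambda>x::'a. inverse (norm x) *\<^sub>R x) \<in> borel \<rightarrow>\<^sub>M borel"
    by measurable
  then have "(sgn :: 'a \<Rightarrow> 'a) \<in> borel \<rightarrow>\<^sub>M borel"
    by (simp add: sgn_div_norm[abs_def])
  then show "(sgn :: 'a \<Rightarrow> 'a) \<in> restrict_space lborel (ball 0 1 - {0}) \<rightarrow>\<^sub>M borel"
    by (intro measurable_restrict_space1) simp
qed

lemma emeasure_sphere_measure:
  fixes A :: "'a::euclidean_space set"
  assumes "A \<in> sets borel" "A \<subseteq> sphere 0 1"
  shows "emeasure sphere_measure A =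
           of_nat DIM('a) * emeasure lborel {r *\<^sub>R \<omega> |r \<omega>. 0 < r \<and> r < 1 \<and> \<omega> \<in> A}"
proof -
  have A: "A \<in> sets (restrict_space borel (sphere 0 1))"
    using assms by (auto simp: sets_restrict_space_iff)
  have eq: "sgn -` A \<inter> (ball 0 1 - {0}) = {r *\<^sub>R \<omega> |r \<omega>. 0 < r \<and> r < 1 \<and> \<omega> \<in> A}" (is "?L = ?R")
  proof
    show "?L \<subseteq> ?R"
    proof
      fix x assume x: "x \<in> ?L"
      then have "x = norm x *\<^sub>R sgn x" by (simp add: sgn_div_norm)
      with x show "x \<in> ?R" by (intro CollectI exI[of _ "norm x"] exI[of _ "sgn x"]) auto
    qed
    show "?R \<subseteq> ?L"
      using assms(2) by (auto simp: sgn_scaleR sgn_div_norm subset_iff)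
  qed
  have "emeasure sphere_measure A = of_nat DIM('a) *
      emeasure (restrict_space lborel (ball 0 1 - {0::'a})) (sgn -` A \<inter> (ball 0 1 - {0}))"
    using emeasure_distr[OF measurable_sgn_sphere A]
    by (simp add: sphere_measure_def space_restrict_space)
  also have "emeasure (restrict_space lborel (ball 0 1 - {0::'a})) (sgn -` A \<inter> (ball 0 1 - {0}))
      = emeasure lborel (sgn -` A \<inter> (ball 0 1 - {0}))"
    by (rule emeasure_restrict_space) auto
  finally show ?thesis by (simp add: eq)
qed

lemma sphere_measure_real: "(sphere_measure :: real measure) = count_space {-1, 1}"
proof -
  have sp: "sphere (0::real) 1 = {-1, 1}" by (auto simp: abs_if split: if_splits)
  have S: "sets (sphere_measure :: real measure) = Pow {-1, 1}"
    unfolding sets_sphere_measure sp sets_restrict_space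
    by (auto simp: image_iff intro!: bexI[of _ "_::real set"] borel_closed finite_imp_closed
             dest: finite_subset)
  have 1: "{r *\<^sub>R \<omega> |r \<omega>. 0 < r \<and> r < 1 \<and> \<omega> \<in> {1::real}} = {0<..<1}" by auto
  have 2: "{r *\<^sub>R \<omega> |r \<omega>. 0 < r \<and> r < 1 \<and> \<omega> \<in> {-1::real}} = {-1<..<0}"
    by (auto intro: exI[of _ "- _ :: real"])
  have "emeasure sphere_measure {x} = 1" if "x \<in> {-1, 1}" for x :: real
    using that emeasure_sphere_measure[of "{1::real}"] emeasure_sphere_measure[of "{-1::real}"]
    unfolding 1 2 by auto
  then show ?thesis
    by (intro measure_eqI_countable[of _ "{-1,1}"]) (auto simp: S)
qed

subsection \<open>Fourier transform and fractional Laplacian\<close>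

definition fourier :: "('a::euclidean_space \<Rightarrow> complex) \<Rightarrow> 'a \<Rightarrow> complex" where
  "fourier f \<xi> = (LINT x|lborel. f x * cis (- 2 * pi * (x \<bullet> \<xi>)))"

definition inverse_fourier :: "('a::euclidean_space \<Rightarrow> complex) \<Rightarrow> 'a \<Rightarrow> complex" where
  "inverse_fourier g x = (LINT \<xi>|lborel. g \<xi> * cis (2 * pi * (x \<bullet> \<xi>)))"

definition frac_laplacian_const :: "nat \<Rightarrow> real \<Rightarrow> real" where
  "frac_laplacian_const N s =
     2 powr (2 * s) * s * Gamma ((real N + 2 * s) / 2) / (pi powr (real N / 2) * Gamma (1 - s))"

text \<open>\<open>has_frac_laplacian s f x l\<close>: the truncated integrals converge absolutely, the principal value
  exists, and \<open>(-\<Delta>)\<^sup>s f (x) = l\<close>.\<close>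

definition has_frac_laplacian ::
  "real \<Rightarrow> ('a::euclidean_space \<Rightarrow> complex) \<Rightarrow> 'a \<Rightarrow> complex \<Rightarrow> bool" where
  "has_frac_laplacian s f x l \<longleftrightarrow>
     (\<forall>\<epsilon>>0. set_integrable lborel {y. norm (y - x) > \<epsilon>}
        (\<lambda>y. (f x - f y) /\<^sub>R (norm (x - y) powr (real DIM('a) + 2 * s)))) \<and>
     ((\<lambda>\<epsilon>. frac_laplacian_const DIM('a) s *\<^sub>R
         (LINT y:{y. norm (y - x) > \<epsilon>}|lborel.
            (f x - f y) /\<^sub>R (norm (x - y) powr (real DIM('a) + 2 * s)))) \<longlongrightarrow> l) (at_right 0)"

subsection \<open>The Cauchy problem for the fractional wave equation\<close>

text \<open>Only the values \<open>w x t\<close> with \<open>t \<ge> 0\<close> matter; the initial velocity is a one-sided derivative.\<close>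

definition solves_fractional_wave ::
  "real \<Rightarrow> ('a::euclidean_space \<Rightarrow> complex) \<Rightarrow> ('a \<Rightarrow> real \<Rightarrow> complex) \<Rightarrow> bool" where
  "solves_fractional_wave s u0 w \<longleftrightarrow>
     (\<exists>wt wtt.
        (\<forall>x. \<forall>t>0. (w x has_vector_derivative wt x t) (at t) \<and>
                    (wt x has_vector_derivative wtt x t) (at t) \<and>
                    (\<exists>l. has_frac_laplacian s (\<lambda>z. w z t) x l \<and> wtt x t + l = 0))) \<and>
     (\<forall>x. w x 0 = 0) \<and>
     (\<forall>x. (w x has_vector_derivative u0 x) (at 0 within {0..}))"

text \<open>The Fourier representation singles out one solution; its other properties hold automatically
  for \<open>u0 \<in> C\<^sub>0\<^sup>\<infinity>\<close>. At \<open>\<xi> = 0\<close> the multiplier takes the value \<open>0 / 0 = 0\<close>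
  instead of its limit \<open>t\<close>, which does not affect the integral.\<close>

definition the_fractional_wave ::
  "real \<Rightarrow> ('a::euclidean_space \<Rightarrow> complex) \<Rightarrow> ('a \<Rightarrow> real \<Rightarrow> complex) \<Rightarrow> bool" where
  "the_fractional_wave s u0 w \<longleftrightarrow>
     smooth_on (UNIV \<times> {0<..}) (\<lambda>(x, t). w x t) \<and>
     solves_fractional_wave s u0 w \<and>
     (\<forall>x. \<forall>t\<ge>0. w x t =
        inverse_fourier
          (\<lambda>\<xi>. complex_of_real (sin (t * (2 * pi * norm \<xi>) powr s) / (2 * pi * norm \<xi>) powr s)
                 * fourier u0 \<xi>) x)"

end

theory Submission
  imports Defs "HOL-Probability.Characteristic_Functions" "HOL-Probability.Sinc_Integral"
    "HOL-Real_Asymp.Real_Asymp"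
begin

text \<open>Both conditions are equivalent to the vanishing of all Gaussian integrals
  \<open>\<integral> u\<^sub>0(x) exp(-b|x|\<^sup>2) dx\<close>, \<open>b > 0\<close>, which up to a nonzero factor are the Gaussian integrals
  \<open>\<integral> \<F>u\<^sub>0(\<xi>) exp(-a|\<xi>|\<^sup>2) d\<xi>\<close> with \<open>a = \<pi>\<^sup>2/b\<close>.

  On the physical side, Weierstrass approximation by polynomials in \<open>exp(-|x|\<^sup>2)\<close> turns vanishing
  Gaussian integrals into vanishing integrals over all balls about the origin; comparing \<open>u\<^sub>0\<close> on a
  thin shell \<open>a \<le> |x| < b\<close> with its radial projection to the sphere of radius \<open>a\<close> relates the
  latter to the spherical means without any integration in polar coordinates.

  On the Fourier side, with \<open>\<tau> = (2\<pi>|\<xi>|)\<^sup>s\<close>, differentiating \<open>\<integral> sin(t\<tau>)/\<tau> \<F>u\<^sub>0 d\<xi> = 0\<close> in \<open>t\<close>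
  gives the vanishing of all cosine integrals of \<open>\<F>u\<^sub>0\<close>, hence, approximating on
  \<open>[0, K]\<close> by polynomials in \<open>cos(\<pi>\<tau>/K)\<close> and letting \<open>K \<rightarrow> \<infinity>\<close>, of its integral against every
  bounded continuous function of \<open>\<tau>\<close>. Conversely, \<open>sin(t\<tau>)/\<tau>\<close> vanishes at infinity and is thus
  a continuous function of \<open>exp(-|\<xi>|\<^sup>2)\<close> on \<open>[0, 1]\<close>.\<close>

subsection \<open>Gaussians and the Fourier transform\<close>

text \<open>Lebesgue measure is the image of the product of its one-dimensional copies under the
  coordinate map, so Fubini for finite products applies. This reduces Gaussians and the majorant of
  \<open>integrable_fourier\<close> to dimension one.\<close>

lemma
  fixes f :: "'a::euclidean_space \<Rightarrow> real \<Rightarrow> complex"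
  assumes "\<And>b. b \<in> Basis \<Longrightarrow> integrable lborel (f b)"
  shows lborel_product_integrable: "integrable lborel (\<lambda>x::'a. \<Prod>b\<in>Basis. f b (x \<bullet> b))"
    and lborel_product_integral:
      "(LINT x|lborel. (\<Prod>b\<in>Basis. f b ((x::'a) \<bullet> b))) = (\<Prod>b\<in>Basis. (LINT t|lborel. f b t))"
proof -
  interpret product_sigma_finite "\<lambda>_::'a. lborel :: real measure"
    by standard
  note [measurable] = borel_measurable_integrable[OF assms]
  have m [measurable]: "(\<lambda>f. \<Sum>b\<in>Basis. f b *\<^sub>R b) \<in> Pi\<^sub>M Basis (\<lambda>b::'a. lborel::real measure) \<rightarrow>\<^sub>M borel"
    by measurable
  have m2: "(\<lambda>x::'a. \<Prod>b\<in>Basis. f b (x \<bullet> b)) \<in> borel \<rightarrow>\<^sub>M borel"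
  proof (intro borel_measurable_prod)
    fix b :: 'a assume "b \<in> Basis"
    then have "f b \<in> borel \<rightarrow>\<^sub>M borel" using borel_measurable_integrable[OF assms] by simp
    then show "(\<lambda>x::'a. f b (x \<bullet> b)) \<in> borel \<rightarrow>\<^sub>M borel" by measurable
  qed
  have *: "integrable (Pi\<^sub>M Basis (\<lambda>b::'a. lborel::real measure)) (\<lambda>x. \<Prod>b\<in>Basis. f b (x b))"
    by (rule product_integrable_prod) (auto simp: assms)
  show "integrable lborel (\<lambda>x::'a. \<Prod>b\<in>Basis. f b (x \<bullet> b))"
    using * by (subst lborel_eq, subst integrable_distr_eq[OF m m2])
      (simp add: inner_sum_left inner_Basis if_distrib cong: if_cong prod.cong)
  show "(LINT x|lborel. (\<Prod>b\<in>Basis. f b ((x::'a) \<bullet> b))) = (\<Prod>b\<in>Basis. (LINT t|lborel. f b t))"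
    using product_integral_prod[of Basis f] assms
    by (subst lborel_eq, subst integral_distr[OF m m2])
      (simp add: inner_sum_left inner_Basis if_distrib cong: if_cong prod.cong)
qed

text \<open>This is the characteristic function of the standard normal distribution, rescaled by
  \<open>c = sqrt (2 * a)\<close> so that \<open>a * t^2 = (c * t)^2 / 2\<close>.\<close>

lemma gaussian_fourier_1d:
  fixes y a :: real
  assumes a: "0 < a"
  shows "integrable lborel (\<lambda>t. complex_of_real (exp (- a * t\<^sup>2)) * cis (y * t))"
    and "(LINT t|lborel. complex_of_real (exp (- a * t\<^sup>2)) * cis (y * t))
           = complex_of_real (sqrt (pi / a) * exp (- y\<^sup>2 / (4 * a)))"
proof -
  define c where "c = sqrt (2 * a)"
  have c: "c > 0" "c\<^sup>2 = 2 * a" using a by (auto simp: c_def)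
  have i0: "integrable lborel (\<lambda>t::real. complex_of_real (std_normal_density t) * iexp (u * t))" for u
    by (rule Bochner_Integration.integrable_bound[of _ std_normal_density])
       (auto simp: norm_mult)
  have v0: "(LINT t|lborel. complex_of_real (std_normal_density t) * iexp (u * t)) = complex_of_real (exp (- (u^2) / 2))" for u
  proof -
    have "(LINT t|lborel. complex_of_real (std_normal_density t) * iexp (u * t)) = char std_normal_distribution u"
      unfolding char_def by (subst integral_density) (auto simp: scaleR_conv_of_real)
    then show ?thesis by (simp add: char_std_normal_distribution)
  qed
  \<comment> \<open>The form \<open>0 + c * t\<close> fits the affine change of variables with zero
    translation.\<close>
  have eq: "complex_of_real (exp (- a * t\<^sup>2)) * cis (y * t) =
      complex_of_real (sqrt (2 * pi)) * (complex_of_real (std_normal_density (0 + c * t)) * iexp ((y / c) * (0 + c * t)))" for t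
    using c a by (auto simp: std_normal_density_def cis_conv_exp power_mult_distrib field_simps)
  show "integrable lborel (\<lambda>t. complex_of_real (exp (- a * t\<^sup>2)) * cis (y * t))"
    unfolding eq using c by (intro integrable_mult_right lborel_integrable_real_affine[OF i0]) auto
  have "(LINT t|lborel. complex_of_real (exp (- a * t\<^sup>2)) * cis (y * t))
     = complex_of_real (sqrt (2 * pi)) * (LINT t|lborel. (complex_of_real (std_normal_density (0 + c * t)) * iexp ((y / c) * (0 + c * t))))"
    unfolding eq by simp
  also have "\<dots> = complex_of_real (sqrt (2 * pi)) * (complex_of_real (1/c) * complex_of_real (exp (- ((y/c)^2) / 2)))"
    using lborel_integral_real_affine[of c "\<lambda>t. complex_of_real (std_normal_density t) * iexp ((y/c) * t)" 0] c
    unfolding v0 by (simp add: scaleR_conv_of_real field_simps)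
  also have "\<dots> = complex_of_real (sqrt (pi / a) * exp (- y\<^sup>2 / (4 * a)))"
  proof -
    have "sqrt (2 * pi) * (1/c) = sqrt (pi / a)"
      using a by (simp add: c_def real_sqrt_divide real_sqrt_mult)
    moreover have "- ((y/c)^2) / 2 = - y\<^sup>2 / (4 * a)"
      using c by (simp add: power_divide)
    ultimately show ?thesis by (metis mult.assoc of_real_mult)
  qed
  finally show "(LINT t|lborel. complex_of_real (exp (- a * t\<^sup>2)) * cis (y * t))
           = complex_of_real (sqrt (pi / a) * exp (- y\<^sup>2 / (4 * a)))" .
qed

text \<open>Gaussian and character both factor over the coordinates. In the normalization of
  \<open>fourier\<close> the parameter \<open>a\<close> turns into \<open>pi^2 / a\<close>.\<close>

lemma fourier_gaussian:
  fixes x :: "'a::euclidean_space"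
  assumes a: "0 < a"
  shows "integrable lborel (\<lambda>\<xi>::'a. exp (- a * (norm \<xi>)\<^sup>2))"
    and "fourier (\<lambda>\<xi>. complex_of_real (exp (- a * (norm \<xi>)\<^sup>2))) x
         = complex_of_real (sqrt (pi / a) ^ DIM('a) * exp (- (pi\<^sup>2 / a) * (norm x)\<^sup>2))"
proof -
  have nrm: "(norm z)\<^sup>2 = (\<Sum>b\<in>Basis. (z \<bullet> b)\<^sup>2)" for z :: 'a
    unfolding power2_norm_eq_inner euclidean_inner[of z z] by (simp only: power2_eq_square)
  have cisp: "(\<Prod>b\<in>A. cis (h b)) = cis (\<Sum>b\<in>A. h b)" for h and A :: "'a set"
    by (induction A rule: infinite_finite_induct) (auto simp: cis_mult)
  have eq: "complex_of_real (exp (- a * (norm \<xi>)\<^sup>2)) * cis (- 2 * pi * (\<xi> \<bullet> z)) =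
      (\<Prod>b\<in>Basis. complex_of_real (exp (- a * (\<xi> \<bullet> b)\<^sup>2)) * cis ((- 2 * pi * (z \<bullet> b)) * (\<xi> \<bullet> b)))" for \<xi> z :: 'a
    unfolding prod.distrib cisp of_real_prod[symmetric] exp_sum[OF finite_Basis, symmetric]
      nrm sum_distrib_left euclidean_inner[of \<xi> z]
    by (simp add: mult_ac)
  have i: "integrable lborel (\<lambda>\<xi>::'a. complex_of_real (exp (- a * (norm \<xi>)\<^sup>2)) * cis (- 2 * pi * (\<xi> \<bullet> z)))" for z
    unfolding eq by (rule lborel_product_integrable) (rule gaussian_fourier_1d[OF a])
  \<comment> \<open>At frequency zero the character is 1, which leaves the Gaussian itself.\<close>
  from i[of 0] have "integrable lborel (\<lambda>\<xi>::'a. complex_of_real (exp (- a * (norm \<xi>)\<^sup>2)))" by simp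
  then show "integrable lborel (\<lambda>\<xi>::'a. exp (- a * (norm \<xi>)\<^sup>2))"
    unfolding complex_of_real_integrable_eq .
  have "fourier (\<lambda>\<xi>. complex_of_real (exp (- a * (norm \<xi>)\<^sup>2))) x =
     (\<Prod>b\<in>Basis. complex_of_real (sqrt (pi / a) * exp (- (- 2 * pi * (x \<bullet> b))\<^sup>2 / (4 * a))))"
    unfolding fourier_def eq
    by (subst lborel_product_integral) (simp_all only: gaussian_fourier_1d[OF a])
  also have "\<dots> = complex_of_real (sqrt (pi / a) ^ DIM('a) * exp (- (pi\<^sup>2 / a) * (norm x)\<^sup>2))"
    unfolding of_real_prod[symmetric] prod.distrib exp_sum[OF finite_Basis, symmetric]
      nrm sum_distrib_left prod_constant
    using a by (intro arg_cong[where f=complex_of_real] arg_cong2[where f="(*)"] refl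
      arg_cong[where f=exp] sum.cong) (auto simp: field_simps power2_eq_square)
  finally show "fourier (\<lambda>\<xi>. complex_of_real (exp (- a * (norm \<xi>)\<^sup>2))) x
         = complex_of_real (sqrt (pi / a) ^ DIM('a) * exp (- (pi\<^sup>2 / a) * (norm x)\<^sup>2))" .
qed

section \<open>Multiplication formula and Gaussian integrals of a Fourier transform\<close>

lemma borel_measurable_cis [measurable]: "cis \<in> borel \<rightarrow>\<^sub>M borel"
  by (intro borel_measurable_continuous_onI continuous_intros)

lemma borel_measurable_fourier:
  fixes f :: "'a::euclidean_space \<Rightarrow> complex"
  assumes [measurable]: "f \<in> borel_measurable borel"
  shows "fourier f \<in> borel_measurable borel"
proof -
  have "(\<lambda>(\<xi>::'a, x::'a). f x * cis (- 2 * pi * (x \<bullet> \<xi>))) \<in> borel_measurable (borel \<Otimes>\<^sub>M lborel)"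
    by measurable
  from lborel.borel_measurable_lebesgue_integral[OF this] show ?thesis
    by (simp add: fourier_def[abs_def])
qed

text \<open>Fubini for the kernel \<open>h\<close>, whose modulus is the integrable product of
  \<open>norm (f x)\<close> and \<open>norm (g \<xi>)\<close>; the character is symmetric in its two
  variables.\<close>

lemma fourier_multiplication_formula:
  fixes f g :: "'a::euclidean_space \<Rightarrow> complex"
  assumes f: "integrable lborel f" and g: "integrable lborel g"
  shows "(LINT \<xi>|lborel. fourier f \<xi> * g \<xi>) = (LINT x|lborel. f x * fourier g x)"
proof -
  note [measurable] = borel_measurable_integrable[OF f] borel_measurable_integrable[OF g]
  define h where "h = (\<lambda>x \<xi>::'a. f x * g \<xi> * cis (- 2 * pi * (x \<bullet> \<xi>)))"
  have [measurable]: "f \<in> borel \<rightarrow>\<^sub>M borel" "g \<in> borel \<rightarrow>\<^sub>M borel"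
    using borel_measurable_integrable[OF f] borel_measurable_integrable[OF g] by auto
  have m: "(\<lambda>(x, \<xi>). h x \<xi>) \<in> borel_measurable (lborel \<Otimes>\<^sub>M lborel)"
    unfolding h_def by measurable
  have "integrable (lborel \<Otimes>\<^sub>M lborel) (\<lambda>(x, \<xi>). f x * g \<xi>)"
  proof (rule lborel_pair.Fubini_integrable)
    show "(\<lambda>(x, \<xi>). f x * g \<xi>) \<in> borel_measurable (lborel \<Otimes>\<^sub>M lborel)" by measurable
    show "integrable lborel (\<lambda>x. LINT y|lborel. norm (case (x, y) of (x, \<xi>) \<Rightarrow> f x * g \<xi>))"
      using f by (simp add: norm_mult)
    show "AE x in lborel. integrable lborel (\<lambda>y. case (x, y) of (x, \<xi>) \<Rightarrow> f x * g \<xi>)"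
      using g by simp
  qed
  then have "integrable (lborel \<Otimes>\<^sub>M lborel) (\<lambda>(x, \<xi>). h x \<xi>)"
    by (rule Bochner_Integration.integrable_bound) (use m in \<open>auto simp: h_def norm_mult\<close>)
  from lborel_pair.Fubini_integral[OF this]
  have "(LINT \<xi>|lborel. (LINT x|lborel. h x \<xi>)) = (LINT x|lborel. (LINT \<xi>|lborel. h x \<xi>))" .
  moreover have "(LINT x|lborel. h x \<xi>) = fourier f \<xi> * g \<xi>" for \<xi>
  proof -
    have "h x \<xi> = (f x * cis (- 2 * pi * (x \<bullet> \<xi>))) * g \<xi>" for x by (simp add: h_def mult_ac)
    then show ?thesis by (simp add: fourier_def)
  qed
  moreover have "(LINT \<xi>|lborel. h x \<xi>) = f x * fourier g x" for x
  proof -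
    have "h x \<xi> = f x * (g \<xi> * cis (- 2 * pi * (\<xi> \<bullet> x)))" for \<xi> by (simp add: h_def mult_ac inner_commute)
    then show ?thesis by (simp add: fourier_def)
  qed
  ultimately show ?thesis by simp
qed

lemma gaussian_integral_fourier:
  fixes f :: "'a::euclidean_space \<Rightarrow> complex"
  assumes f: "integrable lborel f" and a: "0 < a"
  shows "(LINT \<xi>|lborel. fourier f \<xi> * complex_of_real (exp (- a * (norm \<xi>)\<^sup>2))) =
    complex_of_real (sqrt (pi / a) ^ DIM('a)) *
    (LINT x|lborel. f x * complex_of_real (exp (- (pi\<^sup>2 / a) * (norm x)\<^sup>2)))"
proof -
  have "(LINT \<xi>|lborel. fourier f \<xi> * complex_of_real (exp (- a * (norm \<xi>)\<^sup>2)))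
    = (LINT x|lborel. f x * fourier (\<lambda>\<xi>. complex_of_real (exp (- a * (norm \<xi>)\<^sup>2))) x)"
    using fourier_gaussian(1)[OF a] by (intro fourier_multiplication_formula f) (simp only: complex_of_real_integrable_eq)
  also have "\<dots> = (LINT x|lborel. complex_of_real (sqrt (pi / a) ^ DIM('a)) * 
       (f x * complex_of_real (exp (- (pi\<^sup>2 / a) * (norm x)\<^sup>2))))"
    by (simp only: fourier_gaussian(2)[OF a] of_real_mult mult_ac)
  finally show ?thesis by simp
qed

text \<open>The map from \<open>a\<close> to \<open>pi^2 / a\<close> is a bijection of the positive
  reals, and the factor relating the two integrals is nonzero.\<close>

lemma gaussian_integrals_fourier_eq_0_iff:
  fixes f :: "'a::euclidean_space \<Rightarrow> complex"
  assumes f: "integrable lborel f"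
  shows "(\<forall>a>0. (LINT \<xi>|lborel. fourier f \<xi> * complex_of_real (exp (- a * (norm \<xi>)\<^sup>2))) = 0) \<longleftrightarrow>
    (\<forall>b>0. (LINT x|lborel. f x * complex_of_real (exp (- b * (norm x)\<^sup>2))) = 0)"
proof -
  have "(LINT x|lborel. f x * complex_of_real (exp (- b * (norm x)\<^sup>2))) = 0"
    if "\<forall>a>0. (LINT \<xi>|lborel. fourier f \<xi> * complex_of_real (exp (- a * (norm \<xi>)\<^sup>2))) = 0" "0 < b" for b
  proof -
    have "sqrt (pi / (pi\<^sup>2 / b)) \<noteq> 0" "pi\<^sup>2 / (pi\<^sup>2 / b) = b" using \<open>0 < b\<close> by auto
    then show ?thesis
      using that(1)[rule_format, of "pi\<^sup>2 / b"] gaussian_integral_fourier[OF f, of "pi\<^sup>2 / b"] \<open>0 < b\<close>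
      by (simp del: real_sqrt_eq_0_iff)
  qed
  moreover have "(LINT \<xi>|lborel. fourier f \<xi> * complex_of_real (exp (- a * (norm \<xi>)\<^sup>2))) = 0"
    if "\<forall>b>0. (LINT x|lborel. f x * complex_of_real (exp (- b * (norm x)\<^sup>2))) = 0" "0 < a" for a
    using that(1)[rule_format, of "pi\<^sup>2 / a"] gaussian_integral_fourier[OF f, of a] \<open>0 < a\<close>
    by (simp del: real_sqrt_eq_0_iff)
  ultimately show ?thesis by blast
qed

subsection \<open>Integrability of the Fourier transform of a test function\<close>

lemma test_function_continuous:
  "test_function f \<Longrightarrow> continuous_on UNIV f"
  by (auto simp: test_function_def smooth_on_def dest: spec[of _ 0])

lemma test_function_differentiable:
  "test_function f \<Longrightarrow> f differentiable (at x)"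
  by (auto simp: test_function_def smooth_on_def dest: spec[of _ "Suc 0"])

lemma eq_0_outside_supp: "x \<notin> supp f \<Longrightarrow> f x = 0"
  unfolding supp_def using closure_subset[of "{x. f x \<noteq> 0}"] by auto

text \<open>The complement of the support is open and \<open>f\<close> vanishes on it, so the
  derivative vanishes there too.\<close>

lemma supp_frechet_derivative:
  fixes f :: "'a::real_normed_vector \<Rightarrow> 'b::real_normed_vector"
  shows "supp (\<lambda>x. frechet_derivative f (at x) v) \<subseteq> supp f"
proof -
  have "frechet_derivative f (at x) v = 0" if x: "x \<notin> supp f" for x
  proof -
    have "open (- supp f)" unfolding supp_def by (intro open_Compl closed_closure)
    then have "(f has_derivative (\<lambda>_. 0)) (at x)"
      by (rule has_derivative_transform_within_open[OF has_derivative_const[of 0]])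
        (use x in \<open>simp_all add: eq_0_outside_supp\<close>)
    then have "(\<lambda>_. 0) = frechet_derivative f (at x)"
      by (rule frechet_derivative_at)
    then show ?thesis by (auto dest: fun_cong[where x=v])
  qed
  then have "{x. frechet_derivative f (at x) v \<noteq> 0} \<subseteq> supp f" by auto
  then show ?thesis
    unfolding supp_def[of "\<lambda>x. frechet_derivative f (at x) v"]
    by (rule closure_minimal) (simp add: supp_def)
qed

lemma test_function_frechet_derivative:
  assumes "test_function f"
  shows "test_function (\<lambda>x. frechet_derivative f (at x) v)"
proof -
  have "compact (supp (\<lambda>x. frechet_derivative f (at x) v))"
    using assms supp_frechet_derivative[of f v] unfolding test_function_def
    by (metis closed_closure compact_Int_closed inf.absorb2 supp_def)
  moreover have "Ck_on k UNIV (\<lambda>x. frechet_derivative f (at x) v)" for k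
    using assms by (auto simp: test_function_def smooth_on_def dest: spec[of _ "Suc k"])
  ultimately show ?thesis by (simp add: test_function_def smooth_on_def)
qed

lemma bounded_compact_supp:
  fixes f :: "'a::euclidean_space \<Rightarrow> 'b::real_normed_vector"
  assumes "continuous_on UNIV f" "compact (supp f)"
  obtains B where "0 \<le> B" "\<And>x. norm (f x) \<le> B"
proof -
  have "bounded (f ` supp f)"
    using assms continuous_on_subset compact_continuous_image compact_imp_bounded by blast
  then obtain B where "\<And>x. x \<in> supp f \<Longrightarrow> norm (f x) \<le> B"
    unfolding bounded_iff by auto
  \<comment> \<open>If the support is empty, \<open>B\<close> may be negative; the maximum also
    covers the points off the support.\<close>
  then have "norm (f x) \<le> max B 0" for x
    by (cases "x \<in> supp f") (auto simp: eq_0_outside_supp intro: max.coboundedI1)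
  then show ?thesis using that[of "max B 0"] by auto
qed

lemma integrable_compact_supp:
  fixes f :: "'a::euclidean_space \<Rightarrow> 'b::{banach, second_countable_topology}"
  assumes "continuous_on UNIV f" "compact (supp f)"
  shows "integrable lborel f"
proof -
  have "(\<lambda>x. indicator (supp f) x *\<^sub>R f x) = f"
    by (auto simp: fun_eq_iff indicator_def eq_0_outside_supp)
  then show ?thesis
    using borel_integrable_compact[OF assms(2) continuous_on_subset[OF assms(1)]] by simp
qed

lemma test_function_integrable:
  fixes f :: "'a::euclidean_space \<Rightarrow> 'b::{banach, second_countable_topology}"
  shows "test_function f \<Longrightarrow> integrable lborel f"
  using integrable_compact_supp test_function_continuous by (auto simp: test_function_def)

lemma integrable_fourier_integrand:
  fixes f :: "'a::euclidean_space \<Rightarrow> complex"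
  assumes "integrable lborel f"
  shows "integrable lborel (\<lambda>x. f x * cis (c * (x \<bullet> \<xi>)))"
proof (rule Bochner_Integration.integrable_bound[OF assms])
  have [measurable]: "f \<in> borel_measurable borel" using borel_measurable_integrable[OF assms] by simp
  show "(\<lambda>x. f x * cis (c * (x \<bullet> \<xi>))) \<in> borel_measurable lborel" by measurable
qed (auto simp: norm_mult)

section \<open>Translation, differentiation and decay of the Fourier transform\<close>

lemma norm_fourier_le:
  fixes f :: "'a::euclidean_space \<Rightarrow> complex"
  shows "norm (fourier f \<xi>) \<le> (LINT x|lborel. norm (f x))"
  unfolding fourier_def using integral_norm_bound[of lborel "\<lambda>x. f x * cis (- 2 * pi * (x \<bullet> \<xi>))"]
  by (simp add: norm_mult)

lemma lborel_translation:
  fixes f :: "'a::euclidean_space \<Rightarrow> 'b::{banach, second_countable_topology}"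
  assumes [measurable]: "f \<in> borel_measurable borel"
  shows "(LINT x|lborel. f (c + x)) = (LINT x|lborel. f x)"
    and "integrable lborel f \<Longrightarrow> integrable lborel (\<lambda>x. f (c + x))"
  using integral_distr[of "(+) c" lborel borel f] integrable_distr_eq[of "(+) c" lborel borel f]
  by (simp_all add: lborel_distr_plus)

lemma fourier_translation:
  fixes f :: "'a::euclidean_space \<Rightarrow> complex"
  assumes [measurable]: "f \<in> borel_measurable borel"
  shows "fourier (\<lambda>x. f (c + x)) \<xi> = cis (2 * pi * (c \<bullet> \<xi>)) * fourier f \<xi>"
proof -
  have "fourier (\<lambda>x. f (c + x)) \<xi> =
     (LINT x|lborel. cis (2 * pi * (c \<bullet> \<xi>)) * (f (c + x) * cis (- 2 * pi * ((c + x) \<bullet> \<xi>))))"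
    unfolding fourier_def
    by (intro Bochner_Integration.integral_cong refl)
       (simp add: inner_add_left cis_mult algebra_simps)
  also have "\<dots> = cis (2 * pi * (c \<bullet> \<xi>)) * (LINT x|lborel. (f (c + x) * cis (- 2 * pi * ((c + x) \<bullet> \<xi>))))"
    by simp
  also have "(LINT x|lborel. (f (c + x) * cis (- 2 * pi * ((c + x) \<bullet> \<xi>)))) = fourier f \<xi>"
    unfolding fourier_def by (rule lborel_translation) measurable
  finally show ?thesis .
qed

text \<open>Turns a derivative into a limit along a sequence, the form that dominated convergence
  takes.\<close>

lemma has_vector_derivative_sequentially:
  fixes f :: "real \<Rightarrow> 'b::real_normed_vector"
  assumes "(f has_vector_derivative d) (at 0)" and h: "h \<longlonglongrightarrow> 0" "\<And>n. h n \<noteq> 0"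
  shows "(\<lambda>n. (f (h n) - f 0) /\<^sub>R h n) \<longlonglongrightarrow> d"
proof -
  have lim: "((\<lambda>u. norm (f (0 + u) - f 0 - u *\<^sub>R d) / norm u) \<longlongrightarrow> 0) (at 0)"
    using assms(1) unfolding has_vector_derivative_def has_derivative_at by auto
  have "filterlim h (at 0) sequentially"
    using h by (intro filterlim_atI) auto
  from filterlim_compose[OF lim this]
  have "(\<lambda>n. norm (f (0 + h n) - f 0 - h n *\<^sub>R d) / norm (h n)) \<longlonglongrightarrow> 0" .
  moreover have "norm (f (0 + h n) - f 0 - h n *\<^sub>R d) / norm (h n) = norm ((f (h n) - f 0) /\<^sub>R h n - d)" for n
  proof -
    have "(f (h n) - f 0) /\<^sub>R h n - d = (f (0 + h n) - f 0 - h n *\<^sub>R d) /\<^sub>R h n"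
      using h(2)[of n] by (simp add: scaleR_diff_right)
    then show ?thesis by (simp add: divide_inverse mult.commute)
  qed
  ultimately show ?thesis
    by (simp add: LIM_zero_cancel tendsto_norm_zero_iff)
qed

text \<open>Replaces integration by parts: the difference quotients \<open>D n\<close> along
  \<open>v\<close> converge to the derivative under the integral, while the translation rule
  computes their transforms as difference quotients of a character times
  \<open>fourier f \<xi>\<close>.\<close>

lemma fourier_frechet_derivative:
  fixes f :: "'a::euclidean_space \<Rightarrow> complex"
  assumes f: "test_function f"
  shows "fourier (\<lambda>x. frechet_derivative f (at x) v) \<xi> = 2 * pi * \<i> * (v \<bullet> \<xi>) * fourier f \<xi>"
proof -
  define g where "g = (\<lambda>x. frechet_derivative f (at x) v)"
  define h :: "nat \<Rightarrow> real" where "h n = 1 / real (Suc n)" for n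
  have h: "h n > 0" "h n \<le> 1" for n by (auto simp: h_def)
  have h0: "h \<longlonglongrightarrow> 0" unfolding h_def by (rule LIMSEQ_Suc[OF lim_1_over_n])
  have g: "test_function g" unfolding g_def by (rule test_function_frechet_derivative[OF f])
  note cf = test_function_continuous[OF f] and cg = test_function_continuous[OF g]
  have [measurable]: "f \<in> borel_measurable borel" "g \<in> borel_measurable borel"
    using cf cg by (auto intro: borel_measurable_continuous_onI)
  have fi: "integrable lborel f" by (rule test_function_integrable[OF f])
  obtain B where B: "0 \<le> B" "\<And>x. norm (g x) \<le> B"
    using bounded_compact_supp[OF cg] g by (auto simp: test_function_def)
  have "bounded (supp f)" using f by (auto simp: test_function_def compact_imp_bounded)
  then obtain R where R: "\<And>x. x \<in> supp f \<Longrightarrow> norm x \<le> R" by (auto simp: bounded_iff)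
  have d: "((\<lambda>u. f (x + u *\<^sub>R v)) has_vector_derivative g (x + u *\<^sub>R v)) (at u within S)" for x u S
  proof -
    have "(f has_derivative frechet_derivative f (at (x + u *\<^sub>R v))) (at (x + u *\<^sub>R v))"
      using test_function_differentiable[OF f] frechet_derivative_works by blast
    note df = this
    have dx: "((\<lambda>u. x + u *\<^sub>R v) has_derivative (\<lambda>t. t *\<^sub>R v)) (at u within S)"
      by (auto intro!: derivative_eq_intros)
    have "((\<lambda>u. f (x + u *\<^sub>R v)) has_derivative (\<lambda>t. frechet_derivative f (at (x + u *\<^sub>R v)) (t *\<^sub>R v))) (at u within S)"
      by (rule has_derivative_compose[OF dx df])
    moreover have "linear (frechet_derivative f (at (x + u *\<^sub>R v)))"
      using linear_frechet_derivative[OF test_function_differentiable[OF f]] .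
    ultimately show ?thesis
      by (simp add: has_vector_derivative_def g_def linear_cmul)
  qed
  define D where "D n x = (f (h n *\<^sub>R v + x) - f x) /\<^sub>R h n" for n x
  \<comment> \<open>The mean value inequality bounds the quotients by \<open>B\<close>, and
    \<open>h n \<le> 1\<close> keeps their supports in one fixed ball, so the majorant is
    integrable.\<close>
  have Dbound: "norm (D n x) \<le> indicator (cball 0 (R + norm v)) x *\<^sub>R B" for n x
  proof -
    have "norm (f (x + h n *\<^sub>R v) - f (x + 0 *\<^sub>R v)) \<le> B * norm (h n - 0)"
    proof (rule differentiable_bound[of UNIV _ "\<lambda>u t. t *\<^sub>R g (x + u *\<^sub>R v)"])
      show "((\<lambda>u. f (x + u *\<^sub>R v)) has_derivative (\<lambda>t. t *\<^sub>R g (x + u *\<^sub>R v))) (at u within UNIV)" for u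
        using d by (simp add: has_vector_derivative_def)
      show "onorm (\<lambda>t. t *\<^sub>R g (x + u *\<^sub>R v)) \<le> B" for u
        by (intro onorm_le) (simp add: mult.commute[of B] mult_left_mono B(2))
    qed auto
    then have 1: "norm (D n x) \<le> B"
    proof -
      have "norm (D n x) = norm (f (x + h n *\<^sub>R v) - f x) / h n"
        using h(1)[of n] by (simp add: D_def add.commute[of "h n *\<^sub>R v" x] divide_inverse mult.commute)
      then show ?thesis
        using \<open>norm (f (x + h n *\<^sub>R v) - f (x + 0 *\<^sub>R v)) \<le> B * norm (h n - 0)\<close> h(1)[of n]
        by (simp add: pos_divide_le_eq)
    qed
    have "D n x = 0" if "x \<notin> cball 0 (R + norm v)"
    proof -
      have x: "norm x > R + norm v" using that by simp
      have "norm (h n *\<^sub>R v) \<le> norm v" using h[of n] by (simp add: mult_left_le_one_le)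
      then have "norm (h n *\<^sub>R v + x) > R"
        using x norm_triangle_ineq2[of x "- (h n *\<^sub>R v)"] by (simp add: add.commute)
      moreover have "norm x > R" using x norm_ge_zero[of v] by linarith
      ultimately have "h n *\<^sub>R v + x \<notin> supp f" "x \<notin> supp f" using R by force+
      then show ?thesis by (simp add: D_def eq_0_outside_supp)
    qed
    with 1 show ?thesis by (auto simp: indicator_def)
  qed
  have Dlim: "(\<lambda>n. D n x) \<longlonglongrightarrow> g x" for x
  proof -
    have "h n \<noteq> 0" for n using h(1)[of n] by simp
    from has_vector_derivative_sequentially[OF d[of x 0 UNIV] h0 this]
    show ?thesis by (simp add: D_def add.commute)
  qed
  have "(\<lambda>n. fourier (D n) \<xi>) \<longlonglongrightarrow> fourier g \<xi>"
    unfolding fourier_def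
  proof (rule integral_dominated_convergence[where w="\<lambda>x. indicator (cball 0 (R + norm v)) x *\<^sub>R B"])
    show "integrable lborel (\<lambda>x. indicator (cball 0 (R + norm v)) x *\<^sub>R B)"
      by (rule borel_integrable_compact) auto
    show "AE x in lborel. (\<lambda>i. D i x * cis (- 2 * pi * (x \<bullet> \<xi>))) \<longlonglongrightarrow> g x * cis (- 2 * pi * (x \<bullet> \<xi>))"
      by (intro AE_I2 tendsto_mult Dlim tendsto_const)
    show "AE x in lborel. norm (D i x * cis (- 2 * pi * (x \<bullet> \<xi>))) \<le> indicator (cball 0 (R + norm v)) x *\<^sub>R B" for i
      using Dbound by (simp add: norm_mult)
  qed (simp_all add: D_def)
  \<comment> \<open>Both terms of the difference are integrable, so the integral splits and the
    translation rule applies to the first.\<close>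
  have Dn: "fourier (D n) \<xi> = ((cis (h n * (2 * pi * (v \<bullet> \<xi>))) - 1) /\<^sub>R h n) * fourier f \<xi>" for n
  proof -
    have "fourier (D n) \<xi> = (fourier (\<lambda>x. f (h n *\<^sub>R v + x)) \<xi> - fourier f \<xi>) /\<^sub>R h n"
      unfolding fourier_def D_def scaleR_diff_left[symmetric]
      using integrable_fourier_integrand[OF fi, of "-2*pi" \<xi>] 
        integrable_fourier_integrand[OF lborel_translation(2)[OF _ fi], of "h n *\<^sub>R v" "-2*pi" \<xi>]
      by (simp add: left_diff_distrib flip: Bochner_Integration.integral_diff)
    then show ?thesis
      using fourier_translation[of f "h n *\<^sub>R v" \<xi>] by (simp add: left_diff_distrib scaleR_diff_right mult.left_commute)
  qed
  have L: "(\<lambda>n. (cis (h n * (2 * pi * (v \<bullet> \<xi>))) - 1) /\<^sub>R h n) \<longlonglongrightarrow> 2 * pi * \<i> * (v \<bullet> \<xi>)"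
  proof -
    define c where "c = 2 * pi * (v \<bullet> \<xi>)"
    \<comment> \<open>The scalar quotient is that of \<open>cis (u * c)\<close> at 0, with
      derivative \<open>\<i> * c\<close>.\<close>
    have "((\<lambda>u. cis (u * c)) has_vector_derivative (c *\<^sub>R (\<i> * cis (0 * c)))) (at 0)"
      unfolding has_vector_derivative_def by (auto intro!: derivative_eq_intros simp: algebra_simps)
    moreover have "h n \<noteq> 0" for n using h(1)[of n] by simp
    ultimately have "(\<lambda>n. (cis (h n * c) - cis (0 * c)) /\<^sub>R h n) \<longlonglongrightarrow> c *\<^sub>R (\<i> * cis (0 * c))"
      by (intro has_vector_derivative_sequentially h0)
    then show ?thesis by (simp add: c_def scaleR_conv_of_real mult_ac)
  qed
  have "(\<lambda>n. fourier (D n) \<xi>) \<longlonglongrightarrow> 2 * pi * \<i> * (v \<bullet> \<xi>) * fourier f \<xi>"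
    unfolding Dn by (intro tendsto_mult[OF L] tendsto_const)
  with \<open>(\<lambda>n. fourier (D n) \<xi>) \<longlonglongrightarrow> fourier g \<xi>\<close> show ?thesis
    unfolding g_def by (rule LIMSEQ_unique)
qed

text \<open>Differentiating along \<open>v\<close> multiplies the transform by
  \<open>2 * pi * \<i> * (v \<bullet> \<xi>)\<close>. Hence the bound of order \<open>k\<close> for
  the derivative, again a test function, is one of order \<open>k + 1\<close> for
  \<open>f\<close>.\<close>

lemma fourier_decay:
  fixes f :: "'a::euclidean_space \<Rightarrow> complex"
  assumes "test_function f"
  shows "\<exists>C. \<forall>\<xi>. \<bar>v \<bullet> \<xi>\<bar> ^ k * norm (fourier f \<xi>) \<le> C"
  using assms
proof (induction k arbitrary: f)
  case 0
  then show ?case using norm_fourier_le[of f] by auto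
next
  case (Suc k)
  obtain C where C: "\<And>\<xi>. \<bar>v \<bullet> \<xi>\<bar> ^ k * norm (fourier (\<lambda>x. frechet_derivative f (at x) v) \<xi>) \<le> C"
    using Suc.IH[OF test_function_frechet_derivative[OF Suc.prems]] by auto
  have "\<bar>v \<bullet> \<xi>\<bar> ^ Suc k * norm (fourier f \<xi>) \<le> C / (2 * pi)" for \<xi>
    using C[of \<xi>] unfolding fourier_frechet_derivative[OF Suc.prems]
    by (simp add: norm_mult field_simps)
  then show ?case by blast
qed

text \<open>The transform is dominated by a multiple of the product of \<open>1 / (1 + t^2)\<close>
  over the coordinates \<open>t\<close> of \<open>\<xi>\<close>, which is integrable by the
  one-dimensional case.\<close>

lemma integrable_fourier:
  fixes f :: "'a::euclidean_space \<Rightarrow> complex"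
  assumes f: "test_function f"
  shows "integrable lborel (fourier f)"
proof -
  define N where "N = DIM('a)"
  have "\<forall>b. \<exists>C. \<forall>\<xi>. \<bar>b \<bullet> \<xi>\<bar> ^ (2 * N) * norm (fourier f \<xi>) \<le> C"
    using fourier_decay[OF f] by blast
  then obtain C where C: "\<And>b \<xi>. \<bar>b \<bullet> \<xi>\<bar> ^ (2 * N) * norm (fourier f \<xi>) \<le> C b" by metis
  obtain C0 where C0: "\<And>\<xi>. norm (fourier f \<xi>) \<le> C0" using norm_fourier_le by blast
  define K where "K = 2 ^ N * (C0 + (\<Sum>b\<in>Basis. C b))"
  have bound: "norm (fourier f \<xi>) \<le> K * (\<Prod>b\<in>Basis. inverse (1 + (\<xi> \<bullet> b)\<^sup>2))" for \<xi>
  proof -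
    have Cn: "0 \<le> C b" for b
      using C[of b 0] by (rule order_trans[rotated]) simp
    \<comment> \<open>Take the coordinate \<open>e\<close> of largest modulus at
      \<open>\<xi>\<close>. The product of the \<open>N\<close> factors is then at most
      \<open>(1 + m) ^ N\<close>, so decay of order \<open>2 * N\<close> in the single direction
      \<open>e\<close> suffices.\<close>
    have "Max ((\<lambda>b. \<bar>b \<bullet> \<xi>\<bar>) ` Basis) \<in> (\<lambda>b. \<bar>b \<bullet> \<xi>\<bar>) ` Basis"
      by (intro Max_in) auto
    then obtain e where e: "e \<in> Basis" "Max ((\<lambda>b. \<bar>b \<bullet> \<xi>\<bar>) ` Basis) = \<bar>e \<bullet> \<xi>\<bar>"
      by (auto simp del: Max_in)
    have emax: "\<bar>b \<bullet> \<xi>\<bar> \<le> \<bar>e \<bullet> \<xi>\<bar>" if "b \<in> Basis" for b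
      using that unfolding e(2)[symmetric] by (intro Max_ge) auto
    define m where "m = (e \<bullet> \<xi>)\<^sup>2"
    have "m \<ge> 0" by (simp add: m_def)
    have "(\<Prod>b\<in>Basis. 1 + (\<xi> \<bullet> b)\<^sup>2) \<le> (\<Prod>b\<in>(Basis::'a set). 1 + m)"
      using emax unfolding m_def by (intro prod_mono) (auto simp: inner_commute abs_le_square_iff)
    also have "\<dots> = (1 + m) ^ N" by (simp add: N_def)
    also have "\<dots> \<le> 2 ^ N * (1 + m ^ N)"
    proof (cases "m \<le> 1")
      case True
      then have "(1 + m) ^ N \<le> 2 ^ N" using \<open>m \<ge> 0\<close> by (intro power_mono) auto
      also have "\<dots> \<le> 2 ^ N * (1 + m ^ N)" using \<open>m \<ge> 0\<close> by simp
      finally show ?thesis .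
    next
      case False
      then have "(1 + m) ^ N \<le> (2 * m) ^ N" by (intro power_mono) auto
      also have "\<dots> \<le> 2 ^ N * (1 + m ^ N)" by (simp add: power_mult_distrib)
      finally show ?thesis .
    qed
    finally have "(\<Prod>b\<in>Basis. 1 + (\<xi> \<bullet> b)\<^sup>2) * norm (fourier f \<xi>) \<le> 2 ^ N * (1 + m ^ N) * norm (fourier f \<xi>)"
      by (rule mult_right_mono) simp
    also have "\<dots> = 2 ^ N * (norm (fourier f \<xi>) + \<bar>e \<bullet> \<xi>\<bar> ^ (2 * N) * norm (fourier f \<xi>))"
    proof -
      have "\<bar>e \<bullet> \<xi>\<bar> ^ (2 * N) = m ^ N" by (simp only: m_def power_mult power2_abs)
      then show ?thesis by (simp add: algebra_simps)
    qed
    also have "\<dots> \<le> 2 ^ N * (C0 + C e)"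
      by (intro mult_left_mono add_mono C0 C) simp
    \<comment> \<open>The direction \<open>e\<close> depends on \<open>\<xi>\<close>; summing the
      nonnegative \<open>C b\<close> over all directions makes the constant uniform.\<close>
    also have "\<dots> \<le> K"
      unfolding K_def using e(1) Cn by (intro mult_left_mono add_left_mono member_le_sum) auto
    finally have *: "(\<Prod>b\<in>Basis. 1 + (\<xi> \<bullet> b)\<^sup>2) * norm (fourier f \<xi>) \<le> K" .
    have "(\<Prod>b\<in>Basis. 1 + (\<xi> \<bullet> b)\<^sup>2) > 0"
      by (intro prod_pos) (auto intro: add_pos_nonneg)
    moreover have "(\<Prod>b\<in>Basis. inverse (1 + (\<xi> \<bullet> b)\<^sup>2)) = inverse (\<Prod>b\<in>Basis. 1 + (\<xi> \<bullet> b)\<^sup>2)"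
      using prod_inversef[of "\<lambda>b. 1 + (\<xi> \<bullet> b)\<^sup>2" Basis] by (simp only: o_def)
    ultimately show ?thesis
      using * by (simp add: pos_le_divide_eq mult.commute flip: divide_inverse)
  qed
  have "integrable lborel (\<lambda>t::real. inverse (1 + t\<^sup>2))"
    using integrable_inverse_1_plus_square by (simp add: set_integrable_def einterval_eq)
  \<comment> \<open>The product rule is available for complex factors, hence the passage to complex
    values and back.\<close>
  then have "integrable lborel (\<lambda>t::real. complex_of_real (inverse (1 + t\<^sup>2)))"
    unfolding complex_of_real_integrable_eq .
  then have "integrable lborel (\<lambda>\<xi>::'a. \<Prod>b\<in>Basis. complex_of_real (inverse (1 + (\<xi> \<bullet> b)\<^sup>2)))"
    by (rule lborel_product_integrable)
  then have "integrable lborel (\<lambda>\<xi>::'a. complex_of_real (\<Prod>b\<in>Basis. inverse (1 + (\<xi> \<bullet> b)\<^sup>2)))"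
    by simp
  then have "integrable lborel (\<lambda>\<xi>::'a. \<Prod>b\<in>Basis. inverse (1 + (\<xi> \<bullet> b)\<^sup>2))"
    unfolding complex_of_real_integrable_eq .
  then have *: "integrable lborel (\<lambda>\<xi>::'a. K * (\<Prod>b\<in>Basis. inverse (1 + (\<xi> \<bullet> b)\<^sup>2)))"
    by simp
  have "f \<in> borel_measurable borel"
    using test_function_continuous[OF f] by (rule borel_measurable_continuous_onI)
  then show ?thesis
    using bound borel_measurable_fourier
    by (intro Bochner_Integration.integrable_bound[OF *]) (auto intro!: AE_I2 intro: order_trans[OF _ abs_ge_self])
qed

subsection \<open>Moment problems\<close>

lemma integrable_mult_bounded:
  fixes f :: "'b \<Rightarrow> complex" and h :: "'b \<Rightarrow> real"
  assumes f: "integrable M f" and [measurable]: "h \<in> borel_measurable M" and B: "\<And>x. \<bar>h x\<bar> \<le> B"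
  shows "integrable M (\<lambda>x. f x * complex_of_real (h x))"
proof (rule Bochner_Integration.integrable_bound[OF integrable_mult_left[OF f, of "complex_of_real B"]])
  note [measurable] = borel_measurable_integrable[OF f]
  show "(\<lambda>x. f x * complex_of_real (h x)) \<in> borel_measurable M" by measurable
  show "AE x in M. norm (f x * complex_of_real (h x)) \<le> norm (f x * complex_of_real B)"
    by (intro AE_I2) (auto simp: norm_mult intro!: mult_left_mono order_trans[OF B])
qed

text \<open>By linearity every polynomial in \<open>q\<close> integrates to zero against
  \<open>f\<close>. Polynomials approximate \<open>\<psi>\<close> uniformly on
  \<open>{0..1}\<close>, and the error is at most \<open>e\<close> times the L1 norm of
  \<open>f\<close>.\<close>

lemma integral_continuous_of_moments_eq_0:
  fixes f :: "'b \<Rightarrow> complex" and q \<psi> :: "_ \<Rightarrow> real"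
  assumes f: "integrable M f" and q [measurable]: "q \<in> borel_measurable M"
    and q01: "\<And>x. q x \<in> {0..1}"
    and mom: "\<And>k. (LINT x|M. f x * complex_of_real (q x ^ k)) = 0"
    and \<psi>: "continuous_on {0..1} \<psi>"
  shows "integrable M (\<lambda>x. f x * complex_of_real (\<psi> (q x)))"
    and "(LINT x|M. f x * complex_of_real (\<psi> (q x))) = 0"
proof -
  note [measurable] = borel_measurable_integrable[OF f]
  have "q \<in> M \<rightarrow>\<^sub>M restrict_space borel {0..1}"
    using q01 by (intro measurable_restrict_space2 q) auto
  from measurable_compose[OF this borel_measurable_continuous_on_restrict[OF \<psi>]]
  have [measurable]: "(\<lambda>x. \<psi> (q x)) \<in> borel_measurable M" .
  have "bounded (\<psi> ` {0..1})"
    by (intro compact_imp_bounded compact_continuous_image \<psi>) auto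
  then obtain B where "\<forall>y\<in>{0..1}. \<bar>\<psi> y\<bar> \<le> B"
    by (auto simp: bounded_iff)
  then have B: "\<And>y. y \<in> {0..1} \<Longrightarrow> \<bar>\<psi> y\<bar> \<le> B" by blast
  show int: "integrable M (\<lambda>x. f x * complex_of_real (\<psi> (q x)))"
    using B q01 by (intro integrable_mult_bounded[OF f, of _ B]) auto
  define I where "I = (LINT x|M. norm (f x))"
  have le: "norm (LINT x|M. f x * complex_of_real (\<psi> (q x))) \<le> e * I" if "e > 0" for e
  proof -
    obtain p where "real_polynomial_function p" and p: "\<And>y. y \<in> {0..1} \<Longrightarrow> \<bar>\<psi> y - p y\<bar> < e"
      using Stone_Weierstrass_real_polynomial_function[OF _ \<psi> \<open>e > 0\<close>] by auto
    then obtain a n where p_eq: "p = (\<lambda>y. \<Sum>i\<le>n. a i * y ^ i)"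
      unfolding real_polynomial_function_iff_sum by auto
    have qk: "integrable M (\<lambda>x. f x * complex_of_real (q x ^ k))" for k
      using q01 by (intro integrable_mult_bounded[OF f, of _ 1]) (auto simp: power_le_one)
    have pq: "f x * complex_of_real (p (q x)) = (\<Sum>i\<le>n. complex_of_real (a i) * (f x * complex_of_real (q x ^ i)))" for x
      unfolding p_eq by (simp add: sum_distrib_left mult_ac)
    have intp: "integrable M (\<lambda>x. f x * complex_of_real (p (q x)))"
      unfolding pq by (intro Bochner_Integration.integrable_sum integrable_mult_right qk)
    have "(LINT x|M. f x * complex_of_real (p (q x))) = 0"
      unfolding pq by (subst Bochner_Integration.integral_sum)
        (intro integrable_mult_right qk, simp only: integral_mult_right_zero mom mult_zero_right sum.neutral_const)
    then have "(LINT x|M. f x * complex_of_real (\<psi> (q x))) =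
        (LINT x|M. f x * complex_of_real (\<psi> (q x)) - f x * complex_of_real (p (q x)))"
      using int intp by simp
    also have "norm \<dots> \<le> (LINT x|M. e * norm (f x))"
    proof (rule order_trans[OF integral_norm_bound integral_mono])
      show "integrable M (\<lambda>x. norm (f x * complex_of_real (\<psi> (q x)) - f x * complex_of_real (p (q x))))"
        using int intp by (intro integrable_norm Bochner_Integration.integrable_diff)
      show "integrable M (\<lambda>x. e * norm (f x))" using f by simp
      fix x
      have "norm (f x * complex_of_real (\<psi> (q x)) - f x * complex_of_real (p (q x))) = norm (f x) * \<bar>\<psi> (q x) - p (q x)\<bar>"
        by (metis norm_mult norm_of_real of_real_diff right_diff_distrib)
      also have "\<dots> \<le> e * norm (f x)"
        using p[OF q01[of x]] by (subst mult.commute) (intro mult_right_mono, auto)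
      finally show "norm (f x * complex_of_real (\<psi> (q x)) - f x * complex_of_real (p (q x))) \<le> e * norm (f x)" .
    qed
    finally show ?thesis by (simp add: I_def)
  qed
  have "norm (LINT x|M. f x * complex_of_real (\<psi> (q x))) \<le> 0"
  proof (rule field_le_epsilon)
    fix e :: real assume "e > 0"
    have "I \<ge> 0" by (simp add: I_def)
    \<comment> \<open>The added 1 avoids division by zero when \<open>I = 0\<close>.\<close>
    then have "e / (I + 1) * I \<le> e" using \<open>e > 0\<close> by (simp add: field_simps)
    then show "norm (LINT x|M. f x * complex_of_real (\<psi> (q x))) \<le> 0 + e"
      using le[of "e / (I + 1)"] \<open>e > 0\<close> \<open>I \<ge> 0\<close> by simp
  qed
  then show "(LINT x|M. f x * complex_of_real (\<psi> (q x))) = 0" by simp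
qed

text \<open>Let \<open>b\<close> tend to 0 along \<open>1 / (n + 1)\<close>, dominated by
  \<open>norm (f x)\<close>. This is the limiting case \<open>b = 0\<close>, the zeroth
  moment.\<close>

lemma integral_eq_0_of_gaussian_integrals:
  fixes f :: "'a::euclidean_space \<Rightarrow> complex"
  assumes f: "integrable lborel f"
    and 0: "\<And>b. b > 0 \<Longrightarrow> (LINT x|lborel. f x * complex_of_real (exp (- b * (norm x)\<^sup>2))) = 0"
  shows "(LINT x|lborel. f x) = 0"
proof -
  have [measurable]: "f \<in> borel_measurable borel" using borel_measurable_integrable[OF f] by simp
  have "(\<lambda>n. LINT x|lborel. f x * complex_of_real (exp (- (1 / real (Suc n)) * (norm x)\<^sup>2))) \<longlonglongrightarrow> (LINT x|lborel. f x)"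
  proof (rule integral_dominated_convergence[where w="\<lambda>x. norm (f x)"])
    show "AE x in lborel. (\<lambda>n. f x * complex_of_real (exp (- (1 / real (Suc n)) * (norm x)\<^sup>2))) \<longlonglongrightarrow> f x"
    proof (rule AE_I2)
      fix x :: 'a
      have "(\<lambda>n. f x * complex_of_real (exp (- (1 / real (Suc n)) * (norm x)\<^sup>2))) \<longlonglongrightarrow> f x * complex_of_real (exp (- 0 * (norm x)\<^sup>2))"
        by (intro tendsto_intros LIMSEQ_Suc[OF lim_1_over_n])
      then show "(\<lambda>n. f x * complex_of_real (exp (- (1 / real (Suc n)) * (norm x)\<^sup>2))) \<longlonglongrightarrow> f x" by simp
    qed
    show "AE x in lborel. norm (f x * complex_of_real (exp (- (1 / real (Suc n)) * (norm x)\<^sup>2))) \<le> norm (f x)" for n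
      by (intro AE_I2) (simp add: norm_mult mult_left_le)
  qed (use f in auto)
  moreover have "(LINT x|lborel. f x * complex_of_real (exp (- (1 / real (Suc n)) * (norm x)\<^sup>2))) = 0" for n
    by (rule 0) simp
  ultimately show ?thesis by (simp add: LIMSEQ_const_iff)
qed

text \<open>The \<open>k\<close>-th moment with respect to \<open>exp (- (norm x)^2)\<close> is the
  Gaussian integral with \<open>b = k\<close>; for \<open>k = 0\<close> it is the plain
  integral.\<close>

lemma integral_radial_of_gaussian_integrals:
  fixes f :: "'a::euclidean_space \<Rightarrow> complex"
  assumes f: "integrable lborel f"
    and 0: "\<And>b. b > 0 \<Longrightarrow> (LINT x|lborel. f x * complex_of_real (exp (- b * (norm x)\<^sup>2))) = 0"
    and \<psi>: "continuous_on {0..1} \<psi>"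
  shows "(LINT x|lborel. f x * complex_of_real (\<psi> (exp (- (norm x)\<^sup>2)))) = 0"
proof (rule integral_continuous_of_moments_eq_0(2)[OF f _ _ _ \<psi>])
  fix k
  show "(LINT x|lborel. f x * complex_of_real (exp (- (norm x)\<^sup>2) ^ k)) = 0"
  proof (cases "k = 0")
    case True
    then show ?thesis using integral_eq_0_of_gaussian_integrals[OF f 0] by simp
  next
    case False
    then show ?thesis using 0[of "real k"] by (simp flip: exp_of_nat_mult)
  qed
qed auto

lemma ball_integral_of_gaussian_integrals:
  fixes f :: "'a::euclidean_space \<Rightarrow> complex"
  assumes f: "integrable lborel f"
    and 0: "\<And>b. b > 0 \<Longrightarrow> (LINT x|lborel. f x * complex_of_real (exp (- b * (norm x)\<^sup>2))) = 0"
  shows "(LINT x:ball 0 r|lborel. f x) = 0"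
proof (cases "r > 0")
  case False
  then show ?thesis by (simp add: set_lebesgue_integral_def ball_empty)
next
  case True
  have [measurable]: "f \<in> borel_measurable borel" using borel_measurable_integrable[OF f] by simp
  \<comment> \<open>On the sphere of radius \<open>r\<close> the Gaussian equals \<open>c\<close>,
    and it exceeds \<open>c\<close> exactly inside the ball. The ramps \<open>\<psi> n\<close> rise
    from 0 at \<open>c\<close> to 1 at \<open>c + 1 / n\<close> for positive \<open>n\<close>, so
    they converge pointwise to the indicator of the open ball.\<close>
  define c where "c = exp (- r\<^sup>2)"
  define \<psi> where "\<psi> n y = min 1 (real n * max 0 (y - c))" for n y
  have "(\<lambda>n. LINT x|lborel. f x * complex_of_real (\<psi> n (exp (- (norm x)\<^sup>2)))) \<longlonglongrightarrow> (LINT x:ball 0 r|lborel. f x)"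
    unfolding set_lebesgue_integral_def
  proof (rule integral_dominated_convergence[where w="\<lambda>x. norm (f x)"])
    show "AE x in lborel. (\<lambda>n. f x * complex_of_real (\<psi> n (exp (- (norm x)\<^sup>2)))) \<longlonglongrightarrow> indicator (ball 0 r) x *\<^sub>R f x"
    proof (rule AE_I2)
      fix x :: 'a
      let ?q = "exp (- (norm x)\<^sup>2)"
      have "(\<lambda>n. \<psi> n ?q) \<longlonglongrightarrow> indicator (ball 0 r) x"
      proof (cases "norm x < r")
        case less: True
        then have "?q - c > 0" by (simp add: c_def power_strict_mono)
        then obtain m where m: "real m * (?q - c) > 1" using reals_Archimedean3 by blast
        have "eventually (\<lambda>n. \<psi> n ?q = 1) sequentially"
          using eventually_ge_at_top[of m]
        proof eventually_elim
          case (elim n)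
          then have "real m * (?q - c) \<le> real n * (?q - c)"
            using \<open>?q - c > 0\<close> by (intro mult_right_mono) auto
          with m have "real n * (?q - c) > 1" by linarith
          then show ?case using \<open>?q - c > 0\<close> by (simp add: \<psi>_def max_absorb2 min_absorb1)
        qed
        then show ?thesis using less by (simp add: tendsto_eventually)
      next
        case False
        then have "?q \<le> c" using True by (simp add: c_def power_mono)
        then show ?thesis using False by (simp add: \<psi>_def max_def)
      qed
      then have "(\<lambda>n. f x * complex_of_real (\<psi> n ?q)) \<longlonglongrightarrow> f x * complex_of_real (indicator (ball 0 r) x)"
        by (intro tendsto_intros)
      then show "(\<lambda>n. f x * complex_of_real (\<psi> n ?q)) \<longlonglongrightarrow> indicator (ball 0 r) x *\<^sub>R f x"
        by (simp add: scaleR_conv_of_real mult.commute)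
    qed
    show "AE x in lborel. norm (f x * complex_of_real (\<psi> n (exp (- (norm x)\<^sup>2)))) \<le> norm (f x)" for n
      by (intro AE_I2) (auto simp: norm_mult \<psi>_def intro!: mult_left_le)
    have "ball (0::'a) r \<in> sets borel" by simp
    then show "(\<lambda>x. indicator (ball 0 r) x *\<^sub>R f x) \<in> borel_measurable lborel"
      by (intro borel_measurable_scaleR borel_measurable_indicator) auto
  qed (use f in \<open>auto simp: \<psi>_def\<close>)
  moreover have "(LINT x|lborel. f x * complex_of_real (\<psi> n (exp (- (norm x)\<^sup>2)))) = 0" for n
    unfolding \<psi>_def by (intro integral_radial_of_gaussian_integrals f 0 continuous_intros)
  ultimately show ?thesis by (simp add: LIMSEQ_const_iff)
qed

subsection \<open>Spherical means and integrals over balls\<close>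

lemma borel_measurable_sgn_euclidean [measurable]:
  "(sgn :: 'a::euclidean_space \<Rightarrow> 'a) \<in> borel_measurable borel"
proof -
  have "(\<lambda>x::'a. inverse (norm x) *\<^sub>R x) \<in> borel \<rightarrow>\<^sub>M borel" by measurable
  then show ?thesis by (simp add: sgn_div_norm[abs_def])
qed

text \<open>The dilation by \<open>r\<close> leaves \<open>sgn x\<close> unchanged and scales volume
  by the power of \<open>r\<close>. The radius 0 is treated apart, since the dilation
  degenerates.\<close>

lemma set_integral_ball_sgn_scale:
  fixes h :: "'a::euclidean_space \<Rightarrow> 'b::{banach, second_countable_topology}"
  assumes [measurable]: "h \<in> borel_measurable borel" and r: "0 \<le> r"
  shows "(LINT x:ball 0 r|lborel. h (sgn x)) = r ^ DIM('a) *\<^sub>R (LINT x:ball 0 1|lborel. h (sgn x))"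
proof (cases "r = 0")
  case True
  then show ?thesis by (simp add: set_lebesgue_integral_def power_0_left)
next
  case False
  with r have r: "r > 0" by simp
  define k where "k = (\<lambda>x::'a. indicator (ball 0 r) x *\<^sub>R h (sgn x))"
  have [measurable]: "ball (0::'a) r \<in> sets borel" by simp
  have [measurable]: "k \<in> borel_measurable borel" unfolding k_def by measurable
  have kr: "k (r *\<^sub>R x) = indicator (ball 0 1) x *\<^sub>R h (sgn x)" for x
    using r by (auto simp: k_def indicator_def sgn_scaleR)
  have "(LINT x|lborel. k x) = (LINT x|density (distr lborel borel (\<lambda>x::'a. 0 + r *\<^sub>R x)) (\<lambda>_. \<bar>r\<bar> ^ DIM('a)). k x)"
    using lborel_affine[of r "0::'a"] r by simp
  also have "\<dots> = r ^ DIM('a) *\<^sub>R (LINT x|lborel. k (r *\<^sub>R x))"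
    using r by (subst integral_density) (auto simp: integral_distr)
  finally show ?thesis
    by (simp add: set_lebesgue_integral_def k_def[symmetric] kr)
qed

lemma integral_sphere_measure:
  fixes h :: "'a::euclidean_space \<Rightarrow> 'b::{banach, second_countable_topology}"
  assumes [measurable]: "h \<in> borel_measurable borel"
  shows "(LINT \<omega>|sphere_measure. h \<omega>) = real DIM('a) *\<^sub>R (LINT x:ball 0 1|lborel. h (sgn x))"
proof -
  let ?D = "distr (restrict_space lborel (ball 0 1 - {0::'a})) (restrict_space borel (sphere 0 1)) sgn"
  have h: "h \<in> borel_measurable (restrict_space borel (sphere 0 1))"
    by (rule measurable_restrict_space1) fact
  \<comment> \<open>Scaling by a constant is written as a density, for which an integration rule is
    at hand.\<close>
  have "sphere_measure = density ?D (\<lambda>_. ennreal (real DIM('a)))"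
    unfolding sphere_measure_def
    by (rule measure_eqI) (auto simp: emeasure_density nn_integral_cmult_indicator ennreal_of_nat_eq_real_of_nat)
  then have "(LINT \<omega>|sphere_measure. h \<omega>) = (LINT \<omega>|density ?D (\<lambda>_. ennreal (real DIM('a))). h \<omega>)"
    by (rule arg_cong)
  also have "\<dots> = real DIM('a) *\<^sub>R (LINT \<omega>|?D. h \<omega>)"
    using h by (subst integral_density) auto
  also have "(LINT \<omega>|?D. h \<omega>) = (LINT x|restrict_space lborel (ball 0 1 - {0}). h (sgn x))"
    by (rule integral_distr[OF measurable_sgn_sphere h])
  also have "\<dots> = (LINT x|lborel. indicator (ball 0 1 - {0}) x *\<^sub>R h (sgn x))"
    by (rule integral_restrict_space) simp
  also have "\<dots> = (LINT x:ball 0 1|lborel. h (sgn x))"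
    unfolding set_lebesgue_integral_def
  \<comment> \<open>The origin, excluded from the punctured ball, is a null set.\<close>
  proof (rule integral_cong_AE)
    have [measurable]: "ball (0::'a) 1 \<in> sets borel" "{0::'a} \<in> sets borel" by simp_all
    show "(\<lambda>x. indicator (ball 0 1 - {0}) x *\<^sub>R h (sgn x)) \<in> borel_measurable lborel" by measurable
    show "(\<lambda>x. indicator (ball 0 1) x *\<^sub>R h (sgn x)) \<in> borel_measurable lborel" by measurable
    show "AE x in lborel. indicator (ball 0 1 - {0}) x *\<^sub>R h (sgn x) = indicator (ball 0 1) x *\<^sub>R h (sgn x)"
      using AE_lborel_singleton[of "0::'a"] by eventually_elim (simp add: indicator_def)
  qed
  finally show ?thesis .
qed

text \<open>On the shell \<open>a \<le> |x| < b\<close> the function is close to its radial projection to the sphere of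
  radius \<open>a\<close>, whose integral over the shell is given by homogeneity.\<close>

lemma shell_integral_approx:
  fixes f :: "'a::euclidean_space \<Rightarrow> complex"
  assumes f: "continuous_on UNIV f" "integrable lborel f" and ab: "0 \<le> a" "a \<le> b" and "0 \<le> e"
    and close: "\<And>x y. dist x y < b - a \<Longrightarrow> dist (f x) (f y) \<le> e"
  shows "norm ((LINT x:ball 0 b|lborel. f x) - (LINT x:ball 0 a|lborel. f x)
            - (b ^ DIM('a) - a ^ DIM('a)) *\<^sub>R ((LINT \<omega>|sphere_measure. f (a *\<^sub>R \<omega>)) /\<^sub>R real DIM('a)))
          \<le> e * unit_ball_vol DIM('a) * (b ^ DIM('a) - a ^ DIM('a))"
proof -
  have fm [measurable]: "f \<in> borel_measurable borel" using f(1) by (rule borel_measurable_continuous_onI)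
  define S where "S = ball 0 b - ball (0::'a) a"
  define g where "g = (\<lambda>x. f (a *\<^sub>R sgn x))"
  have sub: "ball 0 a \<subseteq> ball (0::'a) b" using ab by auto
  have indS: "indicat_real S x = indicator (ball 0 b) x - indicator (ball 0 a) x" for x
    using sub by (auto simp: S_def indicator_def)
  have [measurable]: "g \<in> borel_measurable borel" unfolding g_def by measurable
  have "bounded (f ` cball 0 a)"
    by (intro compact_imp_bounded compact_continuous_image continuous_on_subset[OF f(1)]) auto
  then obtain B where "\<forall>x\<in>cball 0 a. norm (f x) \<le> B" by (auto simp: bounded_iff)
  then have B: "norm (g x) \<le> B" for x
    using ab by (auto simp: g_def norm_sgn intro!: bspec)
  have ind: "integrable lborel (\<lambda>x::'a. indicator (ball 0 r) x :: real)" for r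
    using emeasure_lborel_ball_finite[of "0::'a" r] by (intro integrable_real_indicator) auto
  have gi: "set_integrable lborel (ball 0 r) g" for r
    unfolding set_integrable_def
  proof (rule Bochner_Integration.integrable_bound)
    show "integrable lborel (\<lambda>x::'a. indicat_real (ball 0 r) x * B)"
      by (rule integrable_mult_left[OF ind])
    have "ball (0::'a) r \<in> sets borel" by simp
    then show "(\<lambda>x. indicat_real (ball 0 r) x *\<^sub>R g x) \<in> borel_measurable lborel"
      by (intro borel_measurable_scaleR borel_measurable_indicator) auto
    show "AE x in lborel. norm (indicat_real (ball 0 r) x *\<^sub>R g x) \<le> norm (indicat_real (ball 0 r) x * B)"
      by (intro AE_I2) (auto simp: indicator_def intro: order_trans[OF B abs_ge_self])
  qed
  have fi: "set_integrable lborel A f" if "A \<in> sets lborel" for A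
    using f(2) that unfolding set_integrable_def by (rule integrable_mult_indicator[rotated])
  have diff: "(LINT x:ball 0 b|lborel. k x) - (LINT x:ball 0 a|lborel. k x) = (LINT x:S|lborel. k x)"
    if "\<And>r. set_integrable lborel (ball 0 r) k" for k :: "'a \<Rightarrow> complex"
  proof -
    have eq: "indicator (ball 0 b) x *\<^sub>R k x - indicator (ball 0 a) x *\<^sub>R k x = indicator S x *\<^sub>R k x" for x
      using sub by (auto simp: S_def indicator_def)
    show ?thesis
      using that unfolding set_lebesgue_integral_def set_integrable_def
      by (subst Bochner_Integration.integral_diff[symmetric]) (simp_all add: eq)
  qed
  have "(LINT x:ball 0 b|lborel. g x) - (LINT x:ball 0 a|lborel. g x) =
     (b ^ DIM('a) - a ^ DIM('a)) *\<^sub>R ((LINT \<omega>|sphere_measure. f (a *\<^sub>R \<omega>)) /\<^sub>R real DIM('a))"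
  proof -
    have "(\<lambda>x. f (a *\<^sub>R x)) \<in> borel_measurable borel" by measurable
    note m = set_integral_ball_sgn_scale[OF this, folded g_def] integral_sphere_measure[OF this, folded g_def]
    show ?thesis
      unfolding m(1)[OF ab(1)] m(1)[OF order_trans[OF ab]] m(2) by (simp add: scaleR_diff_left)
  qed
  then have "(LINT x:ball 0 b|lborel. f x) - (LINT x:ball 0 a|lborel. f x)
            - (b ^ DIM('a) - a ^ DIM('a)) *\<^sub>R ((LINT \<omega>|sphere_measure. f (a *\<^sub>R \<omega>)) /\<^sub>R real DIM('a))
     = (LINT x:S|lborel. f x) - (LINT x:S|lborel. g x)"
    using diff[of f] diff[of g] fi gi by simp
  also have "\<dots> = (LINT x:S|lborel. f x - g x)"
    using fi set_integrable_subset[OF gi[of b], of S]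
    by (intro set_integral_diff(2)[symmetric]) (auto simp: S_def)
  also have "norm \<dots> \<le> (LINT x|lborel. e * indicator S x)"
    unfolding set_lebesgue_integral_def
  proof (rule order_trans[OF integral_norm_bound integral_mono])
    have "set_integrable lborel S (\<lambda>x. f x - g x)"
      using fi set_integrable_subset[OF gi[of b], of S]
      by (intro set_integral_diff(1)) (auto simp: S_def)
    then show "integrable lborel (\<lambda>x. norm (indicat_real S x *\<^sub>R (f x - g x)))"
      unfolding set_integrable_def by (rule integrable_norm)
    show "integrable lborel (\<lambda>x. e * indicat_real S x)"
      using ind[of b] ind[of a] by (simp add: indS)
    fix x
    show "norm (indicat_real S x *\<^sub>R (f x - g x)) \<le> e * indicat_real S x"
    proof (cases "x \<in> S")
      case True
      then have x: "a \<le> norm x" "norm x < b" by (auto simp: S_def)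
      \<comment> \<open>The point and its projection lie on one ray, at distance
        \<open>norm x - a < b - a\<close>, so \<open>close\<close> applies.\<close>
      have "x - a *\<^sub>R sgn x = (norm x - a) *\<^sub>R sgn x"
      proof (cases "x = 0")
        case False
        then have "x = norm x *\<^sub>R sgn x" by (simp add: sgn_div_norm)
        then show ?thesis by (metis scaleR_diff_left)
      qed simp
      then have "dist x (a *\<^sub>R sgn x) \<le> norm x - a"
        using x by (cases "x = 0") (auto simp: dist_norm norm_sgn)
      then have "dist (f x) (g x) \<le> e"
        unfolding g_def using x by (intro close) auto
      with True show ?thesis by (simp add: dist_norm)
    qed simp
  qed
  also have "\<dots> = e * unit_ball_vol DIM('a) * (b ^ DIM('a) - a ^ DIM('a))"
  proof -
    have "(LINT x|lborel. e * indicator S x) = e * ((LINT x|lborel. indicator (ball (0::'a) b) x) - (LINT x|lborel. indicator (ball (0::'a) a) x))"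
      by (simp only: indS integral_mult_right_zero Bochner_Integration.integral_diff[OF ind ind])
    also have "\<dots> = e * (measure lborel (ball (0::'a) b) - measure lborel (ball (0::'a) a))"
      by simp
    finally show ?thesis using ab by (simp add: content_ball algebra_simps)
  qed
  finally show ?thesis .
qed

text \<open>Uniform continuity holds on the compact ball of radius \<open>R + 1\<close>. If one of
  two points at distance below 1 lies outside it, both have norm at least \<open>R\<close>, where
  \<open>f\<close> vanishes.\<close>

lemma uniformly_continuous_compact_supp:
  fixes f :: "'a::euclidean_space \<Rightarrow> 'b::real_normed_vector"
  assumes f: "continuous_on UNIV f" and 0: "\<And>x. norm x \<ge> R \<Longrightarrow> f x = 0" and e: "0 < e"
  obtains d where "0 < d" "\<And>x y. dist x y < d \<Longrightarrow> dist (f x) (f y) \<le> e"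
proof -
  have "uniformly_continuous_on (cball 0 (R + 1)) f"
    by (intro compact_uniformly_continuous continuous_on_subset[OF f]) auto
  then obtain d where d: "0 < d"
    "\<And>x y. x \<in> cball 0 (R + 1) \<Longrightarrow> y \<in> cball 0 (R + 1) \<Longrightarrow> dist y x < d \<Longrightarrow> dist (f y) (f x) < e"
    unfolding uniformly_continuous_on_def using e by meson
  have "dist (f x) (f y) \<le> e" if xy: "dist x y < min d 1" for x y
  proof (cases "x \<in> cball 0 (R + 1) \<and> y \<in> cball 0 (R + 1)")
    case True
    then show ?thesis using d(2)[of y x] xy by simp
  next
    case False
    have "\<bar>norm x - norm y\<bar> < 1"
      using xy norm_triangle_ineq3[of x y] by (simp add: dist_norm)
    with False have "norm x \<ge> R" "norm y \<ge> R" by auto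
    then show ?thesis using 0 e by simp
  qed
  then show ?thesis using that[of "min d 1"] d(1) by auto
qed

text \<open>On a thin shell starting at radius \<open>a\<close> the ball integrals drop out of the
  shell estimate, which then bounds the mean \<open>K\<close> times \<open>D\<close> by an
  arbitrarily small multiple of \<open>D\<close>.\<close>

lemma spherical_means_of_ball_integrals:
  fixes f :: "'a::euclidean_space \<Rightarrow> complex"
  assumes f: "continuous_on UNIV f" "integrable lborel f" and supp: "\<And>x. norm x \<ge> R \<Longrightarrow> f x = 0"
    and ball: "\<And>r. (LINT x:ball 0 r|lborel. f x) = 0" and a: "0 \<le> a"
  shows "(LINT \<omega>|sphere_measure. f (a *\<^sub>R \<omega>)) = 0"
proof -
  define K where "K = (LINT \<omega>|sphere_measure. f (a *\<^sub>R \<omega>)) /\<^sub>R real DIM('a)"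
  let ?V = "unit_ball_vol DIM('a)"
  have V: "?V > 0" by (rule unit_ball_vol_pos) simp
  then have V0: "?V \<noteq> 0" by (rule less_imp_neq[symmetric])
  have "norm K \<le> 0"
  proof (rule field_le_epsilon)
    fix e :: real assume "e > 0"
    define e' where "e' = e / ?V"
    have e': "e' > 0" "e' * ?V = e" using V V0 \<open>e > 0\<close> by (auto simp: e'_def)
    obtain d where d: "0 < d" "\<And>x y. dist x y < d \<Longrightarrow> dist (f x) (f y) \<le> e'"
      using uniformly_continuous_compact_supp[OF f(1) supp e'(1)] by blast
    define D where "D = (a + d) ^ DIM('a) - a ^ DIM('a)"
    have D: "D > 0" using d a by (simp add: D_def power_strict_mono)
    have "norm (D *\<^sub>R K) \<le> e' * ?V * D"
      using shell_integral_approx[OF f a _ less_imp_le[OF e'(1)], of "a + d"] d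
      by (simp add: ball D_def K_def)
    then show "norm K \<le> 0 + e" using D e'(2) by simp
  qed
  then have "K = 0" by simp
  then show ?thesis by (simp only: K_def scaleR_eq_0_iff) simp
qed

text \<open>Cut the ball of radius \<open>R\<close> into \<open>n\<close> thin shells. Each
  contributes only its approximation error, and these errors telescope to at most
  \<open>e' * ?V * R ^ DIM('a) = e\<close>.\<close>

lemma integral_eq_0_of_spherical_means:
  fixes f :: "'a::euclidean_space \<Rightarrow> complex"
  assumes f: "continuous_on UNIV f" "integrable lborel f" and supp: "\<And>x. norm x \<ge> R \<Longrightarrow> f x = 0"
    and S: "\<And>r. 0 \<le> r \<Longrightarrow> (LINT \<omega>|sphere_measure. f (r *\<^sub>R \<omega>)) = 0" and R: "R > 0"
  shows "(LINT x|lborel. f x) = 0"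
proof -
  let ?V = "unit_ball_vol DIM('a)"
  have V: "?V > 0" by (rule unit_ball_vol_pos) simp
  then have V0: "?V \<noteq> 0" by (rule less_imp_neq[symmetric])
  have "norm (LINT x|lborel. f x) \<le> 0"
  proof (rule field_le_epsilon)
    fix e :: real assume "e > 0"
    define e' where "e' = e / (?V * R ^ DIM('a))"
    have e': "e' > 0" "e' * ?V * R ^ DIM('a) = e" using V V0 \<open>e > 0\<close> R by (auto simp: e'_def)
    obtain d where d: "0 < d" "\<And>x y. dist x y < d \<Longrightarrow> dist (f x) (f y) \<le> e'"
      using uniformly_continuous_compact_supp[OF f(1) supp e'(1)] by blast
    \<comment> \<open>The shells must be thinner than the modulus of continuity \<open>d\<close>
      belonging to \<open>e'\<close>.\<close>
    obtain n :: nat where n: "n > 0" "R / n < d"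
    proof -
      obtain n :: nat where n: "R / d < n" using reals_Archimedean2 by blast
      have "0 < R / d" using R d(1) by simp
      with n have "0 < real n" by linarith
      then have "R / n < d" using n d(1) by (simp add: field_simps)
      with \<open>0 < real n\<close> show ?thesis using that by simp
    qed
    define G where "G k = (LINT x:ball 0 (k * (R / n))|lborel. f x)" for k :: nat
    have "norm (G k) \<le> e' * ?V * (k * (R / n)) ^ DIM('a)" for k
    proof (induction k)
      case 0
      then show ?case by (simp add: G_def set_lebesgue_integral_def zero_power)
    next
      case (Suc k)
      define p where "p = real k * (R / n)"
      define q where "q = real (Suc k) * (R / n)"
      have "q - p = R / n" by (simp only: p_def q_def of_nat_Suc ring_distribs)
      moreover have "0 < R / n" using n R by simp
      moreover have "0 \<le> p" using R by (simp add: p_def)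
      ultimately have pq: "0 \<le> p" "p \<le> q" "q - p < d" using n by linarith+
      have G: "G (Suc k) = (LINT x:ball 0 q|lborel. f x)" "G k = (LINT x:ball 0 p|lborel. f x)"
        by (simp_all only: G_def p_def q_def)
      have "norm (G (Suc k) - G k) \<le> e' * ?V * (q ^ DIM('a) - p ^ DIM('a))"
        using shell_integral_approx[OF f pq(1,2) less_imp_le[OF e'(1)] d(2)[OF less_trans[OF _ pq(3)]]]
        by (simp add: G S[OF pq(1)])
      with Suc.IH norm_triangle_sub[of "G (Suc k)" "G k"] show ?case
        unfolding p_def[symmetric] q_def[symmetric] right_diff_distrib by linarith
    qed
    from this[of n] have "norm (G n) \<le> e" using n e'(2) by simp
    \<comment> \<open>The last radius is \<open>R\<close>, beyond which \<open>f\<close>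
      vanishes.\<close>
    moreover have "G n = (LINT x|lborel. f x)"
      unfolding G_def set_lebesgue_integral_def using n supp
      by (intro Bochner_Integration.integral_cong refl) (auto simp: indicator_def)
    ultimately show "norm (LINT x|lborel. f x) \<le> 0 + e" by simp
  qed
  then show ?thesis by simp
qed

subsection \<open>Sine integrals and Gaussian integrals\<close>

text \<open>The cosine kernel is the derivative in \<open>t\<close> at \<open>y\<close> of the sine
  kernel. Symmetric difference quotients express it as a limit, dominated by
  \<open>norm (f x)\<close>.\<close>

lemma cos_integrals_of_sin_integrals:
  fixes f :: "'b \<Rightarrow> complex" and \<tau> :: "'b \<Rightarrow> real"
  assumes f: "integrable M f" and [measurable]: "\<tau> \<in> borel_measurable M" and pos: "AE x in M. \<tau> x \<noteq> 0"
    and 0: "\<And>t. t > 0 \<Longrightarrow> (LINT x|M. f x * complex_of_real (sin (t * \<tau> x) / \<tau> x)) = 0"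
  shows "(LINT x|M. f x * complex_of_real (cos (y * \<tau> x))) = 0"
proof -
  note [measurable] = borel_measurable_integrable[OF f]
  have int: "integrable M (\<lambda>x. f x * complex_of_real (sin (t * \<tau> x) / \<tau> x))" for t
  proof (rule integrable_mult_bounded[OF f])
    show "(\<lambda>x. sin (t * \<tau> x) / \<tau> x) \<in> borel_measurable M" by measurable
    show "\<bar>sin (t * \<tau> x) / \<tau> x\<bar> \<le> \<bar>t\<bar>" for x
      using abs_sin_x_le_abs_x[of "t * \<tau> x"]
      by (cases "\<tau> x = 0") (auto simp: abs_mult pos_divide_le_eq)
  qed
  \<comment> \<open>The sine kernel is odd in \<open>t\<close>, so the vanishing extends to all real
    \<open>t\<close>; the quotients need this because \<open>y - h n\<close> may be
    negative.\<close>
  have all0: "(LINT x|M. f x * complex_of_real (sin (t * \<tau> x) / \<tau> x)) = 0" for t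
  proof (cases t "0 :: real" rule: linorder_cases)
    case less
    then show ?thesis using 0[of "-t"] by simp
  qed (use 0 in auto)
  define h :: "nat \<Rightarrow> real" where "h n = 1 / real (Suc n)" for n
  have h: "h n > 0" for n by (simp add: h_def)
  have h0: "h \<longlonglongrightarrow> 0" unfolding h_def by (rule LIMSEQ_Suc[OF lim_1_over_n])
  \<comment> \<open>\<open>k n\<close> is a difference quotient in \<open>t\<close> of the sine kernel and converges to the cosine kernel.\<close>
  define k where "k n x = cos (y * \<tau> x) * (sin (h n * \<tau> x) / (h n * \<tau> x))" for n x
  have k_eq: "k n x = (sin ((y + h n) * \<tau> x) / \<tau> x - sin ((y - h n) * \<tau> x) / \<tau> x) / (2 * h n)" for n x
  proof -
    have "sin ((y + h n) * \<tau> x) - sin ((y - h n) * \<tau> x) = 2 * cos (y * \<tau> x) * sin (h n * \<tau> x)"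
      by (simp add: distrib_right left_diff_distrib sin_add sin_diff)
    then show ?thesis
      using h[of n] unfolding diff_divide_distrib[symmetric] by (simp add: k_def)
  qed
  have "(LINT x|M. f x * complex_of_real (k n x)) = 0" for n
  proof -
    have "f x * complex_of_real (k n x) = (f x * complex_of_real (sin ((y + h n) * \<tau> x) / \<tau> x)
       - f x * complex_of_real (sin ((y - h n) * \<tau> x) / \<tau> x)) / complex_of_real (2 * h n)" for x
      unfolding k_eq of_real_divide of_real_diff by (simp add: algebra_simps diff_divide_distrib)
    then show ?thesis
      using Bochner_Integration.integral_diff[OF int[of "y + h n"] int[of "y - h n"]]
      by (simp only: integral_divide_zero all0) simp
  qed
  moreover have "(\<lambda>n. LINT x|M. f x * complex_of_real (k n x)) \<longlonglongrightarrow> (LINT x|M. f x * complex_of_real (cos (y * \<tau> x)))"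
  proof (rule integral_dominated_convergence[where w="\<lambda>x. norm (f x)"])
    \<comment> \<open>Where \<open>\<tau> x = 0\<close>, the quotient \<open>0 / 0 = 0\<close> makes
      \<open>k n x\<close> vanish although the cosine is 1; such points form a null set.\<close>
    show "AE x in M. (\<lambda>n. f x * complex_of_real (k n x)) \<longlonglongrightarrow> f x * complex_of_real (cos (y * \<tau> x))"
      using pos
    proof eventually_elim
      case (elim x)
      have "(\<lambda>n. h n * \<tau> x) \<longlonglongrightarrow> 0" using tendsto_mult_left_zero[OF h0] by simp
      moreover have "h n * \<tau> x \<noteq> 0" for n using elim h[of n] by simp
      ultimately have "filterlim (\<lambda>n. h n * \<tau> x) (at 0) sequentially"
        by (intro filterlim_atI) auto
      from filterlim_compose[OF sinc_at_0 this]
      have "(\<lambda>n. k n x) \<longlonglongrightarrow> cos (y * \<tau> x) * 1"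
        unfolding k_def by (intro tendsto_mult tendsto_const)
      then show ?case by (intro tendsto_mult tendsto_of_real tendsto_const) simp
    qed
    have "\<bar>k n x\<bar> \<le> 1" for n x
    proof -
      have "\<bar>sin (h n * \<tau> x) / (h n * \<tau> x)\<bar> \<le> 1"
        using abs_sin_x_le_abs_x[of "h n * \<tau> x"] by (cases "h n * \<tau> x = 0") (auto simp: divide_le_eq_1)
      then show ?thesis
        unfolding k_def abs_mult using abs_cos_le_one[of "y * \<tau> x"] by (intro mult_le_one) auto
    qed
    then show "AE x in M. norm (f x * complex_of_real (k n x)) \<le> norm (f x)" for n
      by (intro AE_I2) (simp add: norm_mult mult_left_le)
  qed (use f in \<open>simp_all add: k_def\<close>)
  ultimately show ?thesis by (simp add: LIMSEQ_const_iff)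
qed

lemma one_plus_cos_half: "(1 + cos v) / 2 \<in> {0..1}" for v :: real
proof -
  have "1 + - 1 \<le> 1 + cos v" by (rule add_left_mono) (rule cos_ge_minus_one)
  then have "0 \<le> 1 + cos v" by (simp only: right_minus)
  then show ?thesis by simp
qed

text \<open>The product-to-sum formula turns one more factor into a combination of cosines with
  frequencies \<open>y\<close> and \<open>y \<plusminus> c\<close>. The free frequency
  \<open>y\<close> is what lets the induction close.\<close>

lemma integral_cos_power:
  fixes f :: "'b \<Rightarrow> complex" and \<tau> :: "'b \<Rightarrow> real"
  assumes f: "integrable M f" and [measurable]: "\<tau> \<in> borel_measurable M"
    and 0: "\<And>y. (LINT x|M. f x * complex_of_real (cos (y * \<tau> x))) = 0"
  shows "(LINT x|M. f x * complex_of_real (((1 + cos (c * \<tau> x)) / 2) ^ k * cos (y * \<tau> x))) = 0"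
proof (induction k arbitrary: y)
  case 0
  then show ?case using assms(3) by simp
next
  case (Suc k)
  define Q where "Q x = ((1 + cos (c * \<tau> x)) / 2) ^ k" for x
  have Q: "\<bar>Q x\<bar> \<le> 1" for x
  proof -
    have "\<bar>(1 + cos (c * \<tau> x)) / 2\<bar> \<le> 1"
      using one_plus_cos_half[of "c * \<tau> x"] unfolding atLeastAtMost_iff by arith
    then show ?thesis unfolding Q_def power_abs by (intro power_le_one) auto
  qed
  have int: "integrable M (\<lambda>x. f x * complex_of_real (Q x * cos (z * \<tau> x)))" for z
  proof (rule integrable_mult_bounded[OF f])
    show "(\<lambda>x. Q x * cos (z * \<tau> x)) \<in> borel_measurable M" unfolding Q_def by measurable
    show "\<bar>Q x * cos (z * \<tau> x)\<bar> \<le> 1" for x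
      unfolding abs_mult using Q abs_cos_le_one by (intro mult_le_one) auto
  qed
  have *: "f x * complex_of_real (((1 + cos (c * \<tau> x)) / 2) ^ Suc k * cos (y * \<tau> x)) =
    1 / 2 * (f x * complex_of_real (Q x * cos (y * \<tau> x)))
    + 1 / 4 * (f x * complex_of_real (Q x * cos ((y + c) * \<tau> x)))
    + 1 / 4 * (f x * complex_of_real (Q x * cos ((y - c) * \<tau> x)))" for x
  proof -
    have "((1 + cos (c * \<tau> x)) / 2) ^ Suc k * cos (y * \<tau> x) =
       1 / 2 * (Q x * cos (y * \<tau> x)) + 1 / 4 * (Q x * cos ((y + c) * \<tau> x)) + 1 / 4 * (Q x * cos ((y - c) * \<tau> x))"
      unfolding power_Suc Q_def[symmetric] ring_distribs cos_add cos_diff left_diff_distrib by (simp add: field_simps)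
    then show ?thesis by (simp only: of_real_add of_real_mult of_real_divide of_real_1 of_real_numeral) (simp add: algebra_simps)
  qed
  show ?case
    unfolding *
    by (simp add: int Suc.IH[folded Q_def] del: of_real_mult)
qed

text \<open>Against each periodic extension of \<open>g\<close> the integral vanishes by polynomial
  approximation. As the period grows, the extensions agree eventually with \<open>g\<close> at every
  value of \<open>\<tau>\<close> and stay bounded by \<open>B\<close>.\<close>

lemma integral_eq_0_of_cos_integrals:
  fixes f :: "'b \<Rightarrow> complex" and \<tau> :: "'b \<Rightarrow> real"
  assumes f: "integrable M f" and \<tau> [measurable]: "\<tau> \<in> borel_measurable M" and nonneg: "\<And>x. 0 \<le> \<tau> x"
    and 0: "\<And>y. (LINT x|M. f x * complex_of_real (cos (y * \<tau> x))) = 0"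
    and g: "continuous_on {0..} g" and B: "\<And>u. 0 \<le> u \<Longrightarrow> \<bar>g u\<bar> \<le> B"
  shows "(LINT x|M. f x * complex_of_real (g (\<tau> x))) = 0"
proof -
  note [measurable] = borel_measurable_integrable[OF f]
  have "\<tau> \<in> M \<rightarrow>\<^sub>M restrict_space borel {0..}"
    using nonneg by (intro measurable_restrict_space2 \<tau>) auto
  from measurable_compose[OF this borel_measurable_continuous_on_restrict[OF g]]
  have [measurable]: "(\<lambda>x. g (\<tau> x)) \<in> borel_measurable M" .
  define K :: "nat \<Rightarrow> real" where "K n = real (Suc n)" for n
  have K: "K n > 0" for n by (simp add: K_def)
  \<comment> \<open>The powers of \<open>q n\<close> span the cosines of period \<open>2 * K n\<close>; since \<open>arccos\<close> inverts \<open>cos\<close> on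
    \<open>{0..pi}\<close>, \<open>\<psi> n \<circ> q n\<close> is the even \<open>2 * K n\<close>-periodic extension of \<open>g\<close> from \<open>{0..K n}\<close>.\<close>
  define q where "q n x = (1 + cos (pi / K n * \<tau> x)) / 2" for n x
  define \<psi> where "\<psi> n y = g (K n / pi * arccos (2 * y - 1))" for n y
  have q01: "q n x \<in> {0..1}" for n x
    unfolding q_def by (rule one_plus_cos_half)
  have qm: "q n \<in> borel_measurable M" for n
    unfolding q_def by measurable
  have \<psi>: "continuous_on {0..1} (\<psi> n)" for n
  proof -
    have "continuous_on {0..1} (\<lambda>y. K n / pi * arccos (2 * y - 1))"
      by (intro continuous_intros) auto
    then show ?thesis
      unfolding \<psi>_def using K[of n]
      by (intro continuous_on_compose2[OF g]) (auto intro!: divide_nonneg_pos mult_nonneg_nonneg arccos_lbound)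
  qed
  \<comment> \<open>Frequency \<open>y = 0\<close> reduces the extra cosine factor to 1.\<close>
  have mom: "(LINT x|M. f x * complex_of_real (q n x ^ k)) = 0" for n k
    using integral_cos_power[OF f \<tau> 0, of "pi / K n" k 0] by (simp add: q_def)
  note \<psi>q = integral_continuous_of_moments_eq_0[OF f qm q01 mom \<psi>]
  have "(\<lambda>n. LINT x|M. f x * complex_of_real (\<psi> n (q n x))) \<longlonglongrightarrow> (LINT x|M. f x * complex_of_real (g (\<tau> x)))"
  proof (rule integral_dominated_convergence[where w="\<lambda>x. norm (f x) * B"])
    show "AE x in M. (\<lambda>n. f x * complex_of_real (\<psi> n (q n x))) \<longlonglongrightarrow> f x * complex_of_real (g (\<tau> x))"
    proof (rule AE_I2)
      fix x
      obtain m :: nat where m: "\<tau> x < real m" using reals_Archimedean2 by blast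
      have "eventually (\<lambda>n. \<psi> n (q n x) = g (\<tau> x)) sequentially"
        using eventually_ge_at_top[of m]
      proof eventually_elim
        case (elim n)
        then have "\<tau> x \<le> K n" using m by (simp add: K_def)
        then have "pi / K n * \<tau> x \<le> pi" using K[of n] by (simp add: field_simps)
        moreover have "0 \<le> pi / K n * \<tau> x" using K[of n] nonneg[of x] by simp
        ultimately have "arccos (cos (pi / K n * \<tau> x)) = pi / K n * \<tau> x" by (intro arccos_cos)
        moreover have "2 * ((1 + v) / 2) - 1 = v" for v :: real by (simp add: field_simps)
        then have "2 * q n x - 1 = cos (pi / K n * \<tau> x)" unfolding q_def .
        ultimately have "K n / pi * arccos (2 * q n x - 1) = \<tau> x" using K[of n] by simp
        then show ?case by (simp only: \<psi>_def)
      qed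
      then have "eventually (\<lambda>n. f x * complex_of_real (\<psi> n (q n x)) = f x * complex_of_real (g (\<tau> x))) sequentially"
        by eventually_elim simp
      then show "(\<lambda>n. f x * complex_of_real (\<psi> n (q n x))) \<longlonglongrightarrow> f x * complex_of_real (g (\<tau> x))"
        by (rule tendsto_eventually)
    qed
    show "AE x in M. norm (f x * complex_of_real (\<psi> n (q n x))) \<le> norm (f x) * B" for n
    proof (rule AE_I2)
      fix x
      have "\<bar>\<psi> n (q n x)\<bar> \<le> B"
        unfolding \<psi>_def using K[of n] q01[of n x]
        by (intro B mult_nonneg_nonneg divide_nonneg_pos arccos_lbound) auto
      then show "norm (f x * complex_of_real (\<psi> n (q n x))) \<le> norm (f x) * B"
        by (simp add: norm_mult mult_left_mono)
    qed
    show "(\<lambda>x. f x * complex_of_real (\<psi> n (q n x))) \<in> borel_measurable M" for n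
      using \<psi>q(1) by (rule borel_measurable_integrable)
  qed (use f in auto)
  then show ?thesis by (simp add: \<psi>q(2) LIMSEQ_const_iff)
qed

section \<open>The wave kernel against Gaussians\<close>

text \<open>This is the wave kernel as a function of \<open>y = exp (- (norm \<xi>)^2)\<close>, with
  \<open>norm \<xi> = sqrt (- ln y)\<close>. Frequency zero is \<open>y = 1\<close>, where
  \<open>sinc\<close> supplies the limit \<open>t\<close>; infinite frequency is
  \<open>y = 0\<close>, where the kernel tends to 0.\<close>

lemma continuous_wave_multiplier:
  fixes s t :: real
  assumes s: "0 < s" and t: "0 < t"
  shows "continuous_on {0..1} (\<lambda>y. if y \<le> 0 then 0 else t * sinc (t * (2 * pi * sqrt (- ln y)) powr s))"
    (is "continuous_on _ ?\<psi>")
proof -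
  have "isCont sinc u" for u by (rule isCont_sinc)
  then have sinc: "continuous_on UNIV sinc" by (simp add: continuous_on_eq_continuous_at)
  have "continuous_on {0<..1} (\<lambda>y::real. t * (2 * pi * sqrt (- ln y)) powr s)"
    using s by (intro continuous_on_mult continuous_on_const continuous_on_powr' continuous_intros) auto
  then have "continuous_on {0<..1} (\<lambda>y. t * sinc (t * (2 * pi * sqrt (- ln y)) powr s))"
    by (rule continuous_on_mult[OF continuous_on_const continuous_on_compose2[OF sinc]]) auto
  then have cont: "continuous_on {0<..1} ?\<psi>"
    by (rule continuous_on_eq) auto
  show ?thesis
    unfolding continuous_on_def
  proof
    fix y :: real assume y: "y \<in> {0..1}"
    show "(?\<psi> \<longlongrightarrow> ?\<psi> y) (at y within {0..1})"
    proof (cases "y = 0")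
      case False
      with y have "(?\<psi> \<longlongrightarrow> ?\<psi> y) (at y within {0<..1})"
        using cont by (auto simp: continuous_on_def)
      moreover have "at y within {0<..1} = at y within {0..1}"
        using False y by (intro at_within_nhd[of _ "{0<..}"]) auto
      ultimately show ?thesis by simp
    next
      case True
      have "((\<lambda>y. 1 / (2 * pi * sqrt (- ln y)) powr s) \<longlongrightarrow> 0) (at_right 0)"
        using s by real_asymp
      \<comment> \<open>Near \<open>y = 0\<close> the sine is bounded by 1, which leaves the decay
        of the reciprocal power.\<close>
      moreover have "eventually (\<lambda>y. norm (?\<psi> y) \<le> 1 / (2 * pi * sqrt (- ln y)) powr s) (at_right 0)"
        using eventually_at_right_less[of 0] eventually_at_rightI[of 0 1 "\<lambda>y. y < (1::real)", simplified]
      proof eventually_elim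
        case (elim y)
        define u where "u = (2 * pi * sqrt (- ln y)) powr s"
        have "u > 0" using elim by (simp add: u_def)
        have "\<bar>t * sinc (t * u)\<bar> \<le> 1 / u"
          using \<open>u > 0\<close> t abs_sin_le_one[of "t * u"] by (simp add: abs_mult divide_right_mono)
        moreover have "norm (?\<psi> y) = \<bar>t * sinc (t * u)\<bar>" unfolding u_def using elim by simp
        ultimately show ?case unfolding u_def by (simp only:)
      qed
      ultimately have "(?\<psi> \<longlongrightarrow> 0) (at_right 0)"
        by (rule Lim_null_comparison[rotated])
      then show ?thesis using True by (simp add: at_within_Icc_at_right)
    qed
  qed
qed

text \<open>Each family of kernels consists of functions of the variable of the other: Gaussians are
  bounded continuous functions of \<open>\<tau>\<close>, and wave kernels are continuous functions
  of one Gaussian on \<open>{0..1}\<close>.\<close>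

lemma wave_integrals_eq_0_iff:
  fixes f :: "'a::euclidean_space \<Rightarrow> complex"
  assumes s: "0 < s" and f: "integrable lborel f"
  shows "(\<forall>t>0. (LINT \<xi>|lborel. f \<xi> * complex_of_real (sin (t * (2 * pi * norm \<xi>) powr s) / (2 * pi * norm \<xi>) powr s)) = 0)
    \<longleftrightarrow> (\<forall>a>0. (LINT \<xi>|lborel. f \<xi> * complex_of_real (exp (- a * (norm \<xi>)\<^sup>2))) = 0)"
    (is "?wave \<longleftrightarrow> ?gauss")
proof
  assume ?wave
  define \<tau> where "\<tau> \<xi> = (2 * pi * norm \<xi>) powr s" for \<xi> :: 'a
  have \<tau>: "\<tau> \<in> borel_measurable lborel" unfolding \<tau>_def by measurable
  have "AE \<xi> in lborel. \<tau> \<xi> \<noteq> 0"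
    using AE_lborel_singleton[of 0] by eventually_elim (simp add: \<tau>_def)
  note cos = cos_integrals_of_sin_integrals[OF f \<tau> this \<open>?wave\<close>[rule_format, folded \<tau>_def]]
  show ?gauss
  proof (intro allI impI)
    fix a :: real assume a: "a > 0"
    \<comment> \<open>The argument of the Gaussian inverts \<open>\<tau>\<close>:
      \<open>u powr (1 / s) / (2 * pi)\<close> recovers \<open>norm \<xi>\<close> from
      \<open>u = \<tau> \<xi>\<close>.\<close>
    define g where "g u = exp (- a * (u powr (1 / s) / (2 * pi))\<^sup>2)" for u :: real
    have "g (\<tau> \<xi>) = exp (- a * (norm \<xi>)\<^sup>2)" for \<xi>
      using s by (simp add: g_def \<tau>_def powr_powr)
    moreover have "(LINT \<xi>|lborel. f \<xi> * complex_of_real (g (\<tau> \<xi>))) = 0"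
    proof (rule integral_eq_0_of_cos_integrals[OF f \<tau> _ cos, where B=1])
      show "continuous_on {0..} g"
        unfolding g_def using s by (intro continuous_intros continuous_on_powr') auto
      show "\<bar>g u\<bar> \<le> 1" for u using a by (simp add: g_def)
    qed (simp_all add: \<tau>_def)
    ultimately show "(LINT \<xi>|lborel. f \<xi> * complex_of_real (exp (- a * (norm \<xi>)\<^sup>2))) = 0" by simp
  qed
next
  assume gauss: ?gauss
  have [measurable]: "f \<in> borel_measurable borel" using borel_measurable_integrable[OF f] by simp
  show ?wave
  proof (intro allI impI)
    fix t :: real assume t: "t > 0"
    define \<psi> where "\<psi> y = (if y \<le> 0 then 0 else t * sinc (t * (2 * pi * sqrt (- ln y)) powr s))" for y
    have "continuous_on {0..1} \<psi>"
      unfolding \<psi>_def by (rule continuous_wave_multiplier[OF s t])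
    from integral_radial_of_gaussian_integrals[OF f _ this] gauss
    have "(LINT \<xi>|lborel. f \<xi> * complex_of_real (\<psi> (exp (- (norm \<xi>)\<^sup>2)))) = 0" by blast
    moreover have "\<psi> (exp (- (norm \<xi>)\<^sup>2)) = t * sinc (t * (2 * pi * norm \<xi>) powr s)" for \<xi> :: 'a
      by (simp add: \<psi>_def)
    ultimately have "(LINT \<xi>|lborel. f \<xi> * complex_of_real (t * sinc (t * (2 * pi * norm \<xi>) powr s))) = 0"
      by simp
    moreover have "(LINT \<xi>|lborel. f \<xi> * complex_of_real (t * sinc (t * (2 * pi * norm \<xi>) powr s))) =
      (LINT \<xi>|lborel. f \<xi> * complex_of_real (sin (t * (2 * pi * norm \<xi>) powr s) / (2 * pi * norm \<xi>) powr s))"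
    \<comment> \<open>The two kernels differ only at \<open>\<xi> = 0\<close>, where
      \<open>sinc\<close> gives \<open>t\<close> and the quotient gives 0.\<close>
    proof (rule integral_cong_AE)
      show "(\<lambda>\<xi>. f \<xi> * complex_of_real (t * sinc (t * (2 * pi * norm \<xi>) powr s))) \<in> borel_measurable lborel"
        by measurable
      show "(\<lambda>\<xi>. f \<xi> * complex_of_real (sin (t * (2 * pi * norm \<xi>) powr s) / (2 * pi * norm \<xi>) powr s)) \<in> borel_measurable lborel"
        by measurable
      show "AE \<xi> in lborel. f \<xi> * complex_of_real (t * sinc (t * (2 * pi * norm \<xi>) powr s)) =
         f \<xi> * complex_of_real (sin (t * (2 * pi * norm \<xi>) powr s) / (2 * pi * norm \<xi>) powr s)"
        using AE_lborel_singleton[of 0] by eventually_elim (use t in simp)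
    qed
    ultimately show "(LINT \<xi>|lborel. f \<xi> * complex_of_real (sin (t * (2 * pi * norm \<xi>) powr s) / (2 * pi * norm \<xi>) powr s)) = 0"
      by (rule trans[OF sym, rotated])
  qed
qed

text \<open>A Gaussian is constant on spheres, so multiplying by it preserves vanishing spherical
  means and the total integral is zero. The converse passes through integrals over balls.\<close>

lemma spherical_means_eq_0_iff:
  fixes f :: "'a::euclidean_space \<Rightarrow> complex"
  assumes f: "continuous_on UNIV f" "integrable lborel f"
    and R: "R > 0" and supp: "\<And>x. norm x \<ge> R \<Longrightarrow> f x = 0"
  shows "(\<forall>r\<ge>0. (LINT \<omega>|sphere_measure. f (r *\<^sub>R \<omega>)) = 0) \<longleftrightarrow>
    (\<forall>b>0. (LINT x|lborel. f x * complex_of_real (exp (- b * (norm x)\<^sup>2))) = 0)"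
proof
  assume S: "\<forall>r\<ge>0. (LINT \<omega>|sphere_measure. f (r *\<^sub>R \<omega>)) = 0"
  show "\<forall>b>0. (LINT x|lborel. f x * complex_of_real (exp (- b * (norm x)\<^sup>2))) = 0"
  proof (intro allI impI)
    fix b :: real assume b: "b > 0"
    show "(LINT x|lborel. f x * complex_of_real (exp (- b * (norm x)\<^sup>2))) = 0"
    proof (rule integral_eq_0_of_spherical_means[OF _ _ _ _ R])
      show "continuous_on UNIV (\<lambda>x. f x * complex_of_real (exp (- b * (norm x)\<^sup>2)))"
        by (intro continuous_intros f)
      show "integrable lborel (\<lambda>x. f x * complex_of_real (exp (- b * (norm x)\<^sup>2)))"
        using b by (intro integrable_mult_bounded[OF f(2), of _ 1]) auto
      show "f x * complex_of_real (exp (- b * (norm x)\<^sup>2)) = 0" if "norm x \<ge> R" for x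
        using supp[OF that] by simp
      fix r :: real assume r: "0 \<le> r"
      have "(LINT \<omega>|sphere_measure. f (r *\<^sub>R \<omega>) * complex_of_real (exp (- b * (norm (r *\<^sub>R \<omega>))\<^sup>2)))
        = (LINT \<omega>|sphere_measure. f (r *\<^sub>R \<omega>) * complex_of_real (exp (- b * r\<^sup>2)))"
        by (rule Bochner_Integration.integral_cong[OF refl]) (simp add: space_sphere_measure)
      then show "(LINT \<omega>|sphere_measure. f (r *\<^sub>R \<omega>) * complex_of_real (exp (- b * (norm (r *\<^sub>R \<omega>))\<^sup>2))) = 0"
        using S r by simp
    qed
  qed
next
  assume "\<forall>b>0. (LINT x|lborel. f x * complex_of_real (exp (- b * (norm x)\<^sup>2))) = 0"
  then show "\<forall>r\<ge>0. (LINT \<omega>|sphere_measure. f (r *\<^sub>R \<omega>)) = 0"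
    using spherical_means_of_ball_integrals[OF f supp ball_integral_of_gaussian_integrals[OF f(2)]] by blast
qed

theorem theorem3p10:
  fixes u0 :: "'a::euclidean_space \<Rightarrow> complex"
    and w :: "'a \<Rightarrow> real \<Rightarrow> complex"
    and s L :: real
  assumes "0 < s" "s < 1"
    and "test_function u0"
    and "L > 0" "supp u0 \<subseteq> ball 0 L"
    and "the_fractional_wave s u0 w"
  shows "(\<forall>t>0. w 0 t = 0) \<longleftrightarrow>
         (\<forall>r\<ge>0. (LINT \<omega>|sphere_measure. u0 (r *\<^sub>R \<omega>)) = 0)"
proof -
  \<comment> \<open>At the origin the character of the inverse transform is 1, leaving the integral
    of \<open>fourier u0\<close> against a radial kernel.\<close>
  have w: "w 0 t = (LINT \<xi>|lborel. fourier u0 \<xi> *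
      complex_of_real (sin (t * (2 * pi * norm \<xi>) powr s) / (2 * pi * norm \<xi>) powr s))" if "t > 0" for t
    using assms(6) that by (simp add: the_fractional_wave_def inverse_fourier_def mult.commute)
  have supp: "u0 x = 0" if "norm x \<ge> L" for x
    using assms(5) that by (intro eq_0_outside_supp) auto
  have "(\<forall>t>0. w 0 t = 0) \<longleftrightarrow>
      (\<forall>t>0. (LINT \<xi>|lborel. fourier u0 \<xi> *
        complex_of_real (sin (t * (2 * pi * norm \<xi>) powr s) / (2 * pi * norm \<xi>) powr s)) = 0)"
    using w by auto
  also have "\<dots> \<longleftrightarrow> (\<forall>a>0. (LINT \<xi>|lborel. fourier u0 \<xi> * complex_of_real (exp (- a * (norm \<xi>)\<^sup>2))) = 0)"
    by (rule wave_integrals_eq_0_iff[OF assms(1) integrable_fourier[OF assms(3)]])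
  also have "\<dots> \<longleftrightarrow> (\<forall>b>0. (LINT x|lborel. u0 x * complex_of_real (exp (- b * (norm x)\<^sup>2))) = 0)"
    by (rule gaussian_integrals_fourier_eq_0_iff[OF test_function_integrable[OF assms(3)]])
  also have "\<dots> \<longleftrightarrow> (\<forall>r\<ge>0. (LINT \<omega>|sphere_measure. u0 (r *\<^sub>R \<omega>)) = 0)"
    by (rule spherical_means_eq_0_iff[OF test_function_continuous[OF assms(3)]
          test_function_integrable[OF assms(3)] assms(4) supp, symmetric])
  finally show ?thesis .
qed

end
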